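(* For all integers $k,r\geq 2$ there is a constant $C=C_{k,r}$, depending only on $k$ and $r$, such that the following holds. For every graph $H$ on $r$ vertices, every positive integer $n$ and every balanced $k$-colouring $c\colon E(K_{nrk}) \to \{1,\dots,k\}$, there is an $H$-factor $F$ of $K_{nrk}$ such that $$\sum_{i=1}^k \left| |E(F)\cap c^{-1}(i)| - \frac{|E(F)|}{k}\right| \leq C.$$ In particular, one may take $C = (8kr)^{(8kr)^k}$.
   Context: $K_N$ denotes the complete graph on $N$ vertices. An edge-colouring is balanced if each colour is used on exactly the same number of edges. For a graph $H$ on $r$ vertices, an $H$-factor of $K_{N}$ (with $r\mid N$) is a subgraph consisting of vertex-disjoint copies of $H$ which together cover all $N$ vertices. Colourings are arbitrary (not necessarily proper) functions on edges. *)

theory Defs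
  imports Complex_Main "HOL-Library.Ramsey"
begin

text \<open>
  A graph is represented by its vertex set and its edge set, an edge being the two-element set
  of its endpoints.
\<close>

type_synonym 'a graph = "'a set \<times> 'a set set"

abbreviation verts :: "'a graph \<Rightarrow> 'a set" where
  "verts G \<equiv> fst G"

abbreviation edges :: "'a graph \<Rightarrow> 'a set set" where
  "edges G \<equiv> snd G"

definition simple_graph :: "'a graph \<Rightarrow> bool" where
  "simple_graph G \<longleftrightarrow> finite (verts G) \<and> edges G \<subseteq> [verts G]\<^bsup>2\<^esup>"

definition complete_graph :: "nat \<Rightarrow> nat graph" where
  "complete_graph N = ({..<N}, [{..<N}]\<^bsup>2\<^esup>)"

definition subgraph :: "'a graph \<Rightarrow> 'a graph \<Rightarrow> bool" where
  "subgraph F G \<longleftrightarrow> simple_graph F \<and> verts F \<subseteq> verts G \<and> edges F \<subseteq> edges G"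

definition isomorphic :: "'a graph \<Rightarrow> 'b graph \<Rightarrow> bool" where
  "isomorphic G H \<longleftrightarrow>
     (\<exists>f. bij_betw f (verts G) (verts H) \<and>
       (\<forall>u\<in>verts G. \<forall>v\<in>verts G. {u, v} \<in> edges G \<longleftrightarrow> {f u, f v} \<in> edges H))"

text \<open>
  \<open>\<C>\<close> is the collection of vertex-disjoint copies of \<open>H\<close>. Copies are subgraphs, not
  necessarily induced ones.
\<close>

definition H_factor :: "'b graph \<Rightarrow> 'a graph \<Rightarrow> 'a graph \<Rightarrow> bool" where
  "H_factor H G F \<longleftrightarrow>
     (\<exists>\<C>. (\<forall>A\<in>\<C>. subgraph A G \<and> isomorphic A H) \<and>
          (\<forall>A\<in>\<C>. \<forall>B\<in>\<C>. A \<noteq> B \<longrightarrow> verts A \<inter> verts B = {}) \<and>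
          verts F = (\<Union>A\<in>\<C>. verts A) \<and> edges F = (\<Union>A\<in>\<C>. edges A) \<and>
          verts F = verts G)"

text \<open>
  An edge-colouring with colours \<open>1, \<dots>, k\<close> is only constrained on the edges of the graph;
  it need not be proper.
\<close>

definition edge_colouring :: "'a graph \<Rightarrow> nat \<Rightarrow> ('a set \<Rightarrow> nat) \<Rightarrow> bool" where
  "edge_colouring G k c \<longleftrightarrow> c \<in> edges G \<rightarrow> {1..k}"

definition colour_class :: "'a graph \<Rightarrow> ('a set \<Rightarrow> nat) \<Rightarrow> nat \<Rightarrow> 'a set set" where
  "colour_class G c i = {e \<in> edges G. c e = i}"

definition balanced_colouring :: "'a graph \<Rightarrow> nat \<Rightarrow> ('a set \<Rightarrow> nat) \<Rightarrow> bool" where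
  "balanced_colouring G k c \<longleftrightarrow>
     edge_colouring G k c \<and>
     (\<forall>i\<in>{1..k}. \<forall>j\<in>{1..k}. card (colour_class G c i) = card (colour_class G c j))"

definition discrepancy :: "'a graph \<Rightarrow> nat \<Rightarrow> ('a set \<Rightarrow> nat) \<Rightarrow> 'a graph \<Rightarrow> real" where
  "discrepancy G k c F =
     (\<Sum>i = 1..k. \<bar>real (card (edges F \<inter> colour_class G c i)) - real (card (edges F)) / real k\<bar>)"

end

theory Submission
  imports Defs "HOL-Combinatorics.Permutations" "HOL-Library.Disjoint_Sets"
begin

text \<open>
  First let \<open>H = K\<^sub>r\<close>, and take the factor minimising the \<open>\<ell>\<^sup>1\<close>-distance \<open>\<Sum>\<^sub>i \<bar>x\<^sub>i\<bar>\<close> of its colour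
  counts from the mean. Summed over all vertex transpositions, the changes of the colour counts
  are exactly \<open>-\<beta> x\<close> with \<open>\<beta>\<close> linear in the number of vertices. Only boundedly many integer vectors
  occur as changes; those that occur only near a bounded set of blocks contribute
  little, and the others can be realised by disjoint, hence independent, transpositions. If \<open>x\<close> were
  large, the sum of the remaining changes would point towards the origin; splitting it into short
  subsums without cancellation gives a bounded number of disjoint transpositions that decrease
  \<open>\<Sum>\<^sub>i \<bar>x\<^sub>i\<bar>\<close>. For general \<open>H\<close>, place a copy of \<open>H\<close> in each block of such a \<open>K\<^sub>r\<close>-factor; the same
  argument, with permutations inside a block as moves, brings the colour counts close to their
  average over all placements, which is a multiple of the colour counts of the \<open>K\<^sub>r\<close>-factor.
\<close>

section \<open>Zero-sum partitions\<close>

text \<open>A negative drift helps only on average: a single move can bring one colour closer to its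
  mean and push another away, and moves sharing a block do not add up. So minimality has to be
  tested against bounded sets of non-interacting moves; boundedness prevents overshooting the
  origin. The same \<open>D\<close> also governs disjointness: at most \<open>D\<close> moves have
  to be replaced, so a vector value can be used once no set of \<open>2 * D\<close> blocks meets all
  its moves. The two stages are forced by degrees. In \<open>transposition_drift\<close> the colour
  degrees of the vertices contribute a constant because all positions have the same degree, as in a
  disjoint union of cliques; a general \<open>H\<close> is not regular. Averaging over all
  permutations of a block works for every \<open>H\<close>, but cannot change which colours the
  block contains, so the clique stage must balance those first. The height of the constant comes
  from treating the colours one at a time, each squaring the size of a zero-sum block.\<close>

lemma bounded_partial_sums:
  fixes g :: "'a \<Rightarrow> int"
  assumes "finite X" "\<And>x. x \<in> X \<Longrightarrow> \<bar>g x\<bar> \<le> B" "sum g X = 0" "B > 0" "l \<le> card X"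
  shows "\<exists>xs. distinct xs \<and> set xs \<subseteq> X \<and> length xs = l \<and>
           (\<forall>t\<le>l. (\<Sum>x\<in>set (take t xs). g x) \<in> {-B<..B})"
  using \<open>l \<le> card X\<close>
proof (induction l)
  case 0
  then show ?case using \<open>B > 0\<close> by simp
next
  case (Suc l)
  then obtain xs where xs: "distinct xs" "set xs \<subseteq> X" "length xs = l"
    "\<And>t. t \<le> l \<Longrightarrow> (\<Sum>x\<in>set (take t xs). g x) \<in> {-B<..B}"
    by (metis Suc_leD)
  define s where "s = sum g (set xs)"
  have s: "s \<in> {-B<..B}" using xs(4)[of l] xs(3) by (simp add: s_def)
  have "card (set xs) < card X" using xs Suc.prems by (simp add: distinct_card)
  then have ne: "X - set xs \<noteq> {}" using xs(2) by auto
  have rest: "sum g (X - set xs) = - s"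
    using assms(1,3) xs(2) by (simp add: sum_diff s_def)
  obtain y where y: "y \<in> X - set xs" "s + g y \<in> {-B<..B}"
  proof (cases "s > 0")
    case True
    then obtain y where "y \<in> X - set xs" "g y < 0"
      using rest by (metis sum_nonneg not_le neg_less_0_iff_less)
    then show ?thesis using that[of y] assms(2)[of y] s True by auto
  next
    case False
    have "\<exists>y\<in>X - set xs. g y \<ge> 0"
    proof (rule ccontr)
      assume "\<not> ?thesis"
      then have "sum g (X - set xs) < (\<Sum>y\<in>X - set xs. 0)"
        using ne \<open>finite X\<close> by (intro sum_strict_mono) (auto simp: not_le)
      then show False using rest False by simp
    qed
    then obtain y where "y \<in> X - set xs" "g y \<ge> 0" by blast
    then show ?thesis using that[of y] assms(2)[of y] s False by auto
  qed
  have "(\<Sum>x\<in>set (take t (xs @ [y])). g x) \<in> {-B<..B}" if "t \<le> Suc l" for t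
  proof (cases "t = Suc l")
    case True
    then show ?thesis using xs(3) y by (simp add: s_def add.commute)
  next
    case False
    then show ?thesis using xs(3) xs(4)[of t] that by simp
  qed
  then show ?case
    using xs y by (intro exI[of _ "xs @ [y]"]) auto
qed

text \<open>A zero-sum set of least size has no smaller nonempty zero-sum subset. In the order given
  by \<open>bounded_partial_sums\<close>, two equal partial sums would enclose one, so the partial
  sums with index below \<open>card X\<close> are distinct elements of a window of
  \<open>2 * B\<close> integers. The full sum is left out since it repeats
  \<open>h 0\<close>.\<close>

lemma small_zero_sum_subset:
  fixes g :: "'a \<Rightarrow> int"
  assumes "finite W" "W \<noteq> {}" "\<And>x. x \<in> W \<Longrightarrow> \<bar>g x\<bar> \<le> B" "sum g W = 0" "B > 0"
  shows "\<exists>X\<subseteq>W. X \<noteq> {} \<and> sum g X = 0 \<and> int (card X) \<le> 2 * B"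
proof -
  define P where "P X \<longleftrightarrow> X \<subseteq> W \<and> X \<noteq> {} \<and> sum g X = 0" for X
  have "P W" using assms by (simp add: P_def)
  then obtain X where X: "P X" and min: "\<And>Y. P Y \<Longrightarrow> card X \<le> card Y"
    by (metis arg_min_nat_lemma)
  have fin: "finite X" using X assms(1) by (auto simp: P_def intro: finite_subset)
  obtain xs where xs: "distinct xs" "set xs \<subseteq> X" "length xs = card X"
    "\<And>t. t \<le> card X \<Longrightarrow> (\<Sum>x\<in>set (take t xs). g x) \<in> {-B<..B}"
    using bounded_partial_sums[OF fin, of g B "card X"] X assms(3,5)
    by (auto simp: P_def)
  define h where "h t = (\<Sum>x\<in>set (take t xs). g x)" for t
  have neq: "h t \<noteq> h t'" if "t < t'" "t' < card X" for t t'
  proof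
    assume eq: "h t = h t'"
    define Y where "Y = set (drop t (take t' xs))"
    have "take t' xs = take t xs @ drop t (take t' xs)"
      using that by (metis append_take_drop_id min.absorb1 less_imp_le take_take)
    then have un: "set (take t' xs) = set (take t xs) \<union> Y" "set (take t xs) \<inter> Y = {}"
      using xs(1) distinct_take[of xs t'] unfolding Y_def
      by (metis set_append) (metis \<open>take t' xs = _\<close> distinct_append distinct_take xs(1))
    then have "h t' = h t + sum g Y"
      unfolding h_def by (subst un(1)) (rule sum.union_disjoint, auto simp: Y_def)
    then have "sum g Y = 0" using eq by simp
    moreover have cY: "card Y = t' - t"
      using xs that unfolding Y_def by (simp add: distinct_card)
    moreover have "Y \<subseteq> X" using xs(2) unfolding Y_def by (meson in_set_dropD in_set_takeD subset_iff)
    ultimately have "P Y" using X that unfolding P_def by auto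
    then show False using min[of Y] cY that by simp
  qed
  then have "inj_on h {..<card X}"
    by (intro inj_onI) (metis lessThan_iff linorder_neqE_nat)
  moreover have "h ` {..<card X} \<subseteq> {-B<..B}"
    using xs(4) unfolding h_def by (auto simp: less_imp_le)
  ultimately have "card {..<card X} \<le> card {-B<..B}"
    by (intro card_inj_on_le) auto
  then have "int (card X) \<le> 2 * B" using assms(5) by simp
  then show ?thesis using X by (auto simp: P_def)
qed

lemma zero_sum_partition_int:
  fixes g :: "'a \<Rightarrow> int"
  assumes "finite W" "\<And>x. x \<in> W \<Longrightarrow> \<bar>g x\<bar> \<le> B" "sum g W = 0" "B > 0"
  shows "\<exists>Q. partition_on W Q \<and> (\<forall>b\<in>Q. sum g b = 0 \<and> int (card b) \<le> 2 * B)"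
  using assms(1-3)
proof (induction W rule: finite_psubset_induct)
  case (psubset W)
  show ?case
  proof (cases "W = {}")
    case True
    then show ?thesis by (intro exI[of _ "{}"]) (simp add: partition_on_def)
  next
    case False
    have "\<exists>X\<subseteq>W. X \<noteq> {} \<and> sum g X = 0 \<and> int (card X) \<le> 2 * B"
      using psubset.hyps(1) False psubset.prems(1,2) \<open>B > 0\<close> by (rule small_zero_sum_subset)
    then obtain X where X: "X \<subseteq> W" "X \<noteq> {}" "sum g X = 0" "int (card X) \<le> 2 * B"
      by blast
    then have "sum g (W - X) = 0"
      using psubset by (simp add: sum_diff)
    then obtain Q where Q: "partition_on (W - X) Q"
      "\<forall>b\<in>Q. sum g b = 0 \<and> int (card b) \<le> 2 * B"
      using psubset.IH[of "W - X"] psubset.prems(1) X(1,2) by auto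
    have "partition_on W (insert X Q)"
      using Q(1) X(1,2) by (subst partition_on_insert) (auto simp: partition_on_def disjnt_def)
    then show ?thesis using Q X by blast
  qed
qed

text \<open>Coordinates are added one at a time. A block of the partition for \<open>I\<close>
  becomes a single integer \<open>g b\<close> of size at most \<open>d * D\<close>, and the
  one-dimensional result groups at most \<open>2 * (d * D)\<close> such blocks. Hence the size bound
  grows from \<open>D\<close> to \<open>2 * d * D * D\<close>, starting at 1, which gives the
  exponent \<open>2 ^ card I - 1\<close>.\<close>

lemma zero_sum_partition:
  fixes f :: "'a \<Rightarrow> 'i \<Rightarrow> int" and d :: nat
  assumes "finite I" "finite W" "d > 0" "\<And>w i. w \<in> W \<Longrightarrow> i \<in> I \<Longrightarrow> \<bar>f w i\<bar> \<le> int d"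
    "\<And>i. i \<in> I \<Longrightarrow> (\<Sum>w\<in>W. f w i) = 0"
  shows "\<exists>P. partition_on W P \<and>
           (\<forall>b\<in>P. card b \<le> (2 * d) ^ (2 ^ card I - 1) \<and> (\<forall>i\<in>I. (\<Sum>w\<in>b. f w i) = 0))"
  using assms(1,4,5)
proof (induction I rule: finite_induct)
  case empty
  have "partition_on W ((\<lambda>w. {w}) ` W)"
    by (auto simp: partition_on_def disjoint_def)
  then show ?case by (intro exI[of _ "(\<lambda>w. {w}) ` W"]) auto
next
  case (insert i I)
  define D where "D = (2 * d) ^ (2 ^ card I - 1)"
  obtain P where P: "partition_on W P" "\<And>b. b \<in> P \<Longrightarrow> card b \<le> D"
    "\<And>b i. b \<in> P \<Longrightarrow> i \<in> I \<Longrightarrow> (\<Sum>w\<in>b. f w i) = 0"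
    using insert unfolding D_def by (metis insert_iff)
  have PW: "\<Union>P = W" "finite P" "\<And>b. b \<in> P \<Longrightarrow> finite b" "\<And>a b. a \<in> P \<Longrightarrow> b \<in> P \<Longrightarrow> a \<noteq> b \<Longrightarrow> a \<inter> b = {}"
    "{} \<notin> P"
    using P(1) assms(2) finite_elements[OF assms(2) P(1)]
    by (auto simp: partition_on_def disjoint_def intro: finite_subset)
  define g where "g b = (\<Sum>w\<in>b. f w i)" for b
  have bound: "\<bar>g b\<bar> \<le> int (d * D)" if "b \<in> P" for b
  proof -
    have "\<bar>g b\<bar> \<le> (\<Sum>w\<in>b. \<bar>f w i\<bar>)" unfolding g_def by (rule sum_abs)
    also have "\<dots> \<le> (\<Sum>w\<in>b. int d)"
      using that PW(1) insert.prems(1) by (intro sum_mono) auto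
    also have "\<dots> \<le> int (d * D)" using P(2)[OF that]
      by (simp add: mult.commute[of "int d"] mult_right_mono)
    finally show ?thesis .
  qed
  have "sum g P = (\<Sum>w\<in>W. f w i)"
    unfolding g_def by (rule sum.partition[OF assms(2) P(1), symmetric])
  then have "sum g P = 0" using insert.prems(2) by simp
  moreover have "int (d * D) > 0" using \<open>d > 0\<close> by (simp add: D_def)
  ultimately obtain Q where Q: "partition_on P Q" "\<And>c. c \<in> Q \<Longrightarrow> sum g c = 0"
    "\<And>c. c \<in> Q \<Longrightarrow> int (card c) \<le> 2 * int (d * D)"
    using zero_sum_partition_int[of P g "int (d * D)"] PW(2) bound by blast
  have QP: "\<And>c. c \<in> Q \<Longrightarrow> c \<subseteq> P" using Q(1) by (auto simp: partition_on_def)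
  have "2 ^ card (insert i I) = 2 * (2::nat) ^ card I" using insert.hyps by simp
  then have "2 ^ card (insert i I) - 1 = (2 ^ card I - 1) + (2 ^ card I - 1) + (1::nat)"
    using one_le_power[of "2::nat" "card I"] by linarith
  then have D': "(2 * d) ^ (2 ^ card (insert i I) - 1) = 2 * d * D * D"
    by (simp only: D_def power_add power_one_right mult_ac)
  have sumU: "(\<Sum>w\<in>\<Union>c. f w j) = (\<Sum>b\<in>c. \<Sum>w\<in>b. f w j)" if "c \<in> Q" for c j
  proof -
    have "(\<Sum>w\<in>\<Union>c. f w j) = (sum \<circ> sum) (\<lambda>w. f w j) c"
      using PW(3,4) QP[OF that] by (intro sum.Union_disjoint) blast+
    then show ?thesis by simp
  qed
  have part: "partition_on W (\<Union> ` Q)"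
  proof (rule partition_onI)
    have "\<Union>Q = P" using Q(1) by (simp add: partition_on_def)
    then show "\<Union> (\<Union> ` Q) = W" using PW(1) by blast
    show "{} \<notin> \<Union> ` Q"
    proof
      assume "{} \<in> \<Union> ` Q"
      then obtain c where "c \<in> Q" "\<Union>c = {}" by auto
      have "c = {}"
      proof (rule ccontr)
        assume "c \<noteq> {}"
        then obtain b where "b \<in> c" by blast
        then have "b = {}" "b \<in> P" using \<open>\<Union>c = {}\<close> QP[OF \<open>c \<in> Q\<close>] by auto
        then show False using PW(5) by simp
      qed
      then show False using \<open>c \<in> Q\<close> Q(1) by (simp add: partition_on_def)
    qed
    fix p q assume "p \<in> \<Union> ` Q" "q \<in> \<Union> ` Q" "p \<noteq> q"
    then obtain a c where ac: "a \<in> Q" "c \<in> Q" "p = \<Union>a" "q = \<Union>c" "a \<noteq> c" by auto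
    then have "a \<inter> c = {}" using Q(1) by (auto simp: partition_on_def disjoint_def)
    have "x \<inter> y = {}" if "x \<in> a" "y \<in> c" for x y
    proof (rule PW(4))
      show "x \<in> P" "y \<in> P" using QP ac that by auto
      show "x \<noteq> y" using \<open>a \<inter> c = {}\<close> that by auto
    qed
    then show "disjnt p q" unfolding ac disjnt_def by blast
  qed
  have "card (\<Union>c) \<le> 2 * d * D * D" if "c \<in> Q" for c
  proof -
    have "card (\<Union>c) \<le> (\<Sum>b\<in>c. card b)" by (rule card_Union_le_sum_card)
    also have "\<dots> \<le> card c * D" using P(2) QP[OF that] sum_bounded_above[of c card D] by auto
    also have "\<dots> \<le> 2 * (d * D) * D" using Q(3)[OF that] by (intro mult_right_mono) linarith+
    finally show ?thesis by (simp add: mult_ac)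
  qed
  moreover have "(\<Sum>w\<in>\<Union>c. f w j) = 0" if "c \<in> Q" "j \<in> insert i I" for c j
  proof (cases "j = i")
    case True
    then show ?thesis using sumU[OF that(1)] Q(2)[OF that(1)] by (simp add: g_def)
  next
    case False
    then have "(\<Sum>b\<in>c. \<Sum>w\<in>b. f w j) = 0"
      using P(3) QP[OF that(1)] that(2) by (intro sum.neutral) blast
    then show ?thesis using sumU[OF that(1)] by simp
  qed
  ultimately show ?case using part D' by (intro exI[of _ "\<Union> ` Q"]) auto
qed

section \<open>Minimality under moves with negative drift\<close>

text \<open>Greedy replacement: the substitutes chosen so far occupy at most \<open>2 * D\<close>
  points, too few to meet every move with the next vector value. Since no \<open>supp j\<close> is
  empty, disjointness also ensures that no substitute is chosen twice.\<close>

lemma disjoint_representatives: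
  fixes \<Delta> :: "'m \<Rightarrow> 'i \<Rightarrow> int" and supp :: "'m \<Rightarrow> 'p set"
  assumes "finite S" "card S \<le> D"
    and supp: "\<And>j. j \<in> J \<Longrightarrow> finite (supp j) \<and> supp j \<noteq> {} \<and> card (supp j) \<le> 2"
    and common: "\<And>j Q. j \<in> S \<Longrightarrow> finite Q \<Longrightarrow> card Q \<le> 2 * D \<Longrightarrow>
                   \<exists>j'\<in>J. (\<forall>i\<in>I. \<Delta> j' i = \<Delta> j i) \<and> supp j' \<inter> Q = {}"
  shows "\<exists>S'\<subseteq>J. finite S' \<and> disjoint_family_on supp S' \<and> card (\<Union>(supp ` S')) \<le> 2 * card S \<and>
           (\<forall>i\<in>I. (\<Sum>j\<in>S'. \<Delta> j i) = (\<Sum>j\<in>S. \<Delta> j i))"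
  using assms(1,2) common
proof (induction S rule: finite_induct)
  case empty
  then show ?case by (intro exI[of _ "{}"]) (auto simp: disjoint_family_on_def)
next
  case (insert j S)
  have "\<exists>S'\<subseteq>J. finite S' \<and> disjoint_family_on supp S' \<and> card (\<Union>(supp ` S')) \<le> 2 * card S \<and>
           (\<forall>i\<in>I. (\<Sum>j\<in>S'. \<Delta> j i) = (\<Sum>j\<in>S. \<Delta> j i))"
    using insert.prems insert.hyps by (intro insert.IH) auto
  then obtain S' where S': "S' \<subseteq> J" "finite S'" "disjoint_family_on supp S'"
    "card (\<Union>(supp ` S')) \<le> 2 * card S" "\<And>i. i \<in> I \<Longrightarrow> (\<Sum>j\<in>S'. \<Delta> j i) = (\<Sum>j\<in>S. \<Delta> j i)"
    by blast
  define Q where "Q = \<Union>(supp ` S')"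
  have "finite Q" using S'(1,2) supp by (auto simp: Q_def)
  moreover have "card Q \<le> 2 * D" using S'(4) insert by (simp add: Q_def)
  ultimately obtain j' where j': "j' \<in> J" "\<And>i. i \<in> I \<Longrightarrow> \<Delta> j' i = \<Delta> j i" "supp j' \<inter> Q = {}"
    using insert.prems(2)[of j Q] by blast
  have "j' \<notin> S'" using supp[OF j'(1)] j'(3) by (auto simp: Q_def)
  moreover have "disjoint_family_on supp (insert j' S')"
    using S'(3) j'(3) by (fastforce simp: disjoint_family_on_def Q_def)
  moreover have "card (supp j' \<union> Q) \<le> 2 * card (insert j S)"
    using card_Un_le[of "supp j'" Q] supp[OF j'(1)] S'(4) insert.hyps by (simp add: Q_def)
  ultimately show ?case
    using S' j' insert.hyps by (intro exI[of _ "insert j' S'"]) (auto simp: Q_def)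
qed

text \<open>
  The set \<open>R\<close> is the union of hitting sets of size at most \<open>L\<close>, one for each of the at most
  \<open>(2 d + 1) ^ card I\<close> vector values whose moves have such a hitting set.
\<close>

lemma rare_values_hitting_set:
  fixes \<Delta> :: "'m \<Rightarrow> 'i \<Rightarrow> int" and supp :: "'m \<Rightarrow> 'p set" and d :: nat
  assumes "finite I" and bound: "\<And>j i. j \<in> J \<Longrightarrow> i \<in> I \<Longrightarrow> \<bar>\<Delta> j i\<bar> \<le> int d"
  shows "\<exists>R. finite R \<and> card R \<le> (2 * d + 1) ^ card I * L \<and>
           (\<forall>j\<in>J. supp j \<inter> R = {} \<longrightarrow> (\<forall>Q. finite Q \<longrightarrow> card Q \<le> L \<longrightarrow>
              (\<exists>j'\<in>J. (\<forall>i\<in>I. \<Delta> j' i = \<Delta> j i) \<and> supp j' \<inter> Q = {})))"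
proof -
  define T where "T = PiE I (\<lambda>_. {- int d..int d})"
  have T: "finite T" "card T = (2 * d + 1) ^ card I"
    using assms(1) by (auto simp: T_def finite_PiE card_PiE nat_add_distrib nat_mult_distrib)
  define hits where "hits t Q \<longleftrightarrow> finite Q \<and> card Q \<le> L \<and>
    (\<forall>j\<in>J. restrict (\<Delta> j) I = t \<longrightarrow> supp j \<inter> Q \<noteq> {})" for t Q
  have "\<exists>R. finite R \<and> card R \<le> L \<and> ((\<exists>Q. hits t Q) \<longrightarrow> hits t R)" for t
  proof (cases "\<exists>Q. hits t Q")
    case True
    then show ?thesis unfolding hits_def by blast
  next
    \<comment> \<open>A value without a hitting set of size at most \<open>L\<close> contributes
      nothing to \<open>R\<close>; these are the values that can always be realised away from a
      small set.\<close>
    case False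
    then show ?thesis by (intro exI[of _ "{}"]) simp
  qed
  then obtain R where R: "\<And>t. finite (R t) \<and> card (R t) \<le> L" "\<And>t Q. hits t Q \<Longrightarrow> hits t (R t)"
    by metis
  have "card (\<Union>t\<in>T. R t) \<le> (\<Sum>t\<in>T. card (R t))" by (rule card_UN_le[OF T(1)])
  also have "\<dots> \<le> (2 * d + 1) ^ card I * L"
    using sum_bounded_above[of T "\<lambda>t. card (R t)" L] R(1) T(2) by auto
  finally have "card (\<Union>t\<in>T. R t) \<le> (2 * d + 1) ^ card I * L" .
  moreover have "\<exists>j'\<in>J. (\<forall>i\<in>I. \<Delta> j' i = \<Delta> j i) \<and> supp j' \<inter> Q = {}"
    if j: "j \<in> J" "supp j \<inter> (\<Union>t\<in>T. R t) = {}" and Q: "finite Q" "card Q \<le> L" for j Q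
  proof (rule ccontr)
    assume "\<not> ?thesis"
    then have "hits (restrict (\<Delta> j) I) Q"
      using Q unfolding hits_def by (metis restrict_apply)
    then have "hits (restrict (\<Delta> j) I) (R (restrict (\<Delta> j) I))" by (rule R(2))
    moreover have "restrict (\<Delta> j) I \<in> T"
      using bound[OF j(1)] by (auto simp: T_def abs_le_iff) (metis minus_le_iff)
    ultimately show False using j unfolding hits_def by blast
  qed
  ultimately show ?thesis using T(1) R(1) by (intro exI[of _ "\<Union>t\<in>T. R t"]) auto
qed

text \<open>
  The moves in \<open>V\<close>, together with unit vectors cancelling their total \<open>Y\<close>, form a zero-sum family.
  Splitting it into short zero-sum blocks writes \<open>Y\<close> as a sum without cancellation of short
  subsums of \<open>V\<close>; here \<open>n b i\<close> is the number of unit vectors in direction \<open>i\<close> in the block \<open>b\<close>.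
\<close>

lemma conformal_decomposition:
  fixes \<Delta> :: "'m \<Rightarrow> 'i \<Rightarrow> int" and d :: nat
  assumes fin: "finite I" "finite V" and "d > 0"
    and bound: "\<And>j i. j \<in> V \<Longrightarrow> i \<in> I \<Longrightarrow> \<bar>\<Delta> j i\<bar> \<le> int d"
  defines "D \<equiv> (2 * d) ^ (2 ^ card I - 1)" and "Y \<equiv> (\<lambda>i. \<Sum>j\<in>V. \<Delta> j i)"
  shows "\<exists>(P :: ('m + 'i \<times> nat) set set) S n. finite P \<and>
           (\<forall>b\<in>P. S b \<subseteq> V \<and> card (S b) \<le> D \<and>
              (\<forall>i\<in>I. n b i \<le> D \<and> (\<Sum>j\<in>S b. \<Delta> j i) = sgn (Y i) * int (n b i))) \<and>
           (\<forall>i\<in>I. int (\<Sum>b\<in>P. n b i) = \<bar>Y i\<bar>)"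
proof -
  define U where "U = (SIGMA i:I. {..<nat \<bar>Y i\<bar>})"
  define W where "W = Inl ` V \<union> Inr ` U"
  define f where "f w i = (case w of Inl j \<Rightarrow> \<Delta> j i | Inr u \<Rightarrow> if fst u = i then - sgn (Y i) else 0)"
    for w :: "'m + 'i \<times> nat" and i
  have finU: "finite U" using fin by (simp add: U_def)
  have finW: "finite W" using finU fin by (simp add: W_def)
  have sumf: "(\<Sum>w\<in>Inl ` A \<union> Inr ` B. f w i) =
      (\<Sum>j\<in>A. \<Delta> j i) - sgn (Y i) * int (card {u\<in>B. fst u = i})"
    if "finite A" "finite B" for A B i
  proof -
    have "(\<Sum>w\<in>Inl ` A \<union> Inr ` B. f w i) = (\<Sum>w\<in>Inl ` A. f w i) + (\<Sum>w\<in>Inr ` B. f w i)"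
      using that by (intro sum.union_disjoint) auto
    also have "(\<Sum>w\<in>Inl ` A. f w i) = (\<Sum>j\<in>A. \<Delta> j i)"
      by (simp add: sum.reindex f_def)
    also have "(\<Sum>w\<in>Inr ` B. f w i) = (\<Sum>u\<in>B. if fst u = i then - sgn (Y i) else 0)"
      by (simp add: sum.reindex f_def)
    also have "\<dots> = - sgn (Y i) * int (card {u\<in>B. fst u = i})"
      using that by (simp add: sum.If_cases Int_def mult.commute)
    finally show ?thesis by simp
  qed
  have Ui: "card {u\<in>U. fst u = i} = nat \<bar>Y i\<bar>" if "i \<in> I" for i
  proof -
    have "{u\<in>U. fst u = i} = {i} \<times> {..<nat \<bar>Y i\<bar>}" using that by (auto simp: U_def)
    then show ?thesis by (simp add: card_cartesian_product)
  qed
  have "(\<Sum>w\<in>W. f w i) = 0" if "i \<in> I" for i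
    unfolding W_def using sumf[OF fin(2) finU] Ui[OF that]
    by (simp add: Y_def mult_sgn_abs)
  moreover have "\<bar>f w i\<bar> \<le> int d" if "w \<in> W" "i \<in> I" for w i
    using that bound \<open>d > 0\<close> by (auto simp: W_def f_def abs_sgn_eq)
  ultimately obtain P where P: "partition_on W P" "\<And>b. b \<in> P \<Longrightarrow> card b \<le> D"
    "\<And>b i. b \<in> P \<Longrightarrow> i \<in> I \<Longrightarrow> (\<Sum>w\<in>b. f w i) = 0"
    using zero_sum_partition[OF fin(1) finW \<open>d > 0\<close>, of f] unfolding D_def by blast
  define S where "S b = {j. Inl j \<in> b}" for b :: "('m + 'i \<times> nat) set"
  define n where "n b i = card {u. Inr u \<in> b \<and> fst u = i}" for b :: "('m + 'i \<times> nat) set" and i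
  \<comment> \<open>All unit vectors in direction \<open>i\<close> carry the sign opposite to
    \<open>Y i\<close>, so in a zero-sum block the moves must add up to \<open>n b i\<close> units
    in the direction of \<open>Y i\<close>. This is the absence of cancellation.\<close>
  have blk: "S b \<subseteq> V \<and> card (S b) \<le> D \<and>
      (\<forall>i\<in>I. n b i \<le> D \<and> (\<Sum>j\<in>S b. \<Delta> j i) = sgn (Y i) * int (n b i))" if "b \<in> P" for b
  proof (intro conjI ballI)
    have bW: "b \<subseteq> W" using that P(1) by (auto simp: partition_on_def)
    then have finb: "finite b" using finW finite_subset by blast
    show "S b \<subseteq> V" using bW by (auto simp: S_def W_def)
    have "card (S b) = card (Inl ` S b :: ('m + 'i \<times> nat) set)" by (simp add: card_image)
    also have "\<dots> \<le> card b" using finb by (intro card_mono) (auto simp: S_def)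
    finally show "card (S b) \<le> D" using P(2)[OF that] by simp
    fix i assume "i \<in> I"
    have "n b i = card (Inr ` {u. Inr u \<in> b \<and> fst u = i} :: ('m + 'i \<times> nat) set)"
      unfolding n_def by (simp add: card_image)
    also have "\<dots> \<le> card b" using finb by (intro card_mono) auto
    finally show "n b i \<le> D" using P(2)[OF that] by simp
    have b: "b = Inl ` S b \<union> Inr ` {u. Inr u \<in> b}"
    proof (intro set_eqI)
      fix w show "w \<in> b \<longleftrightarrow> w \<in> Inl ` S b \<union> Inr ` {u. Inr u \<in> b}"
        by (cases w) (auto simp: S_def)
    qed
    have "finite (Inl ` S b :: ('m + 'i \<times> nat) set)" "finite (Inr ` {u. Inr u \<in> b} :: ('m + 'i \<times> nat) set)"
      using finb b by (metis finite_Un)+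
    then have "finite (S b)" "finite {u. Inr u \<in> b}" by (auto dest: finite_imageD)
    from sumf[OF this, of i] show "(\<Sum>j\<in>S b. \<Delta> j i) = sgn (Y i) * int (n b i)"
      using P(3)[OF that \<open>i \<in> I\<close>] b by (simp add: n_def)
  qed
  have "int (\<Sum>b\<in>P. n b i) = \<bar>Y i\<bar>" if "i \<in> I" for i
  proof -
    have "(\<Sum>b\<in>P. n b i) = (\<Sum>b\<in>P. \<Sum>w\<in>b. of_bool (w \<in> Inr ` {u\<in>U. fst u = i}))"
    proof (intro sum.cong refl)
      fix b assume "b \<in> P"
      then have bW: "b \<subseteq> W" using P(1) by (auto simp: partition_on_def)
      then have finb: "finite b" using finW finite_subset by blast
      have "n b i = card (Inr ` {u. Inr u \<in> b \<and> fst u = i} :: ('m + 'i \<times> nat) set)"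
        unfolding n_def by (simp add: card_image)
      also have "Inr ` {u. Inr u \<in> b \<and> fst u = i} = b \<inter> Inr ` {u\<in>U. fst u = i}"
        using bW by (auto simp: W_def)
      also have "card (b \<inter> Inr ` {u\<in>U. fst u = i}) =
          (\<Sum>w\<in>b. of_bool (w \<in> Inr ` {u\<in>U. fst u = i}))"
        using finb by (simp add: Int_def)
      finally show "n b i = (\<Sum>w\<in>b. of_bool (w \<in> Inr ` {u\<in>U. fst u = i}))" .
    qed
    also have "\<dots> = (\<Sum>w\<in>W. of_bool (w \<in> Inr ` {u\<in>U. fst u = i}))"
      by (rule sum.partition[OF finW P(1), symmetric])
    also have "\<dots> = card (W \<inter> Inr ` {u\<in>U. fst u = i})"
      using finW by (simp add: Int_def)
    also have "W \<inter> Inr ` {u\<in>U. fst u = i} = Inr ` {u\<in>U. fst u = i}" by (auto simp: W_def)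
    also have "card \<dots> = nat \<bar>Y i\<bar>" using Ui[OF that] by (simp add: card_image)
    finally show ?thesis by simp
  qed
  then show ?thesis
    using blk finite_elements[OF finW P(1)] by (intro exI[of _ P] exI[of _ S] exI[of _ n]) auto
qed

text \<open>Each block of the conformal decomposition is a change of length at most \<open>D\<close>
  per coordinate that disjoint moves realise, so by minimality its estimated effect, the sum of
  \<open>g i * n b i\<close>, is nonnegative. As nothing cancels, summing over the blocks shows that
  the sum of \<open>g i * \<bar>Y i\<bar>\<close> is nonnegative. But up to the moves meeting
  \<open>R\<close>, \<open>Y\<close> is \<open>- \<beta> * x\<close>, so \<open>g i\<close> is -1
  wherever \<open>\<bar>x i\<bar>\<close> is large. Both the drift and \<open>touch\<close> scale
  with \<open>\<beta>\<close>, so it drops out of the bound.\<close>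

lemma drift_bound:
  fixes \<Delta> :: "'m \<Rightarrow> 'i \<Rightarrow> int" and supp :: "'m \<Rightarrow> 'p set" and x :: "'i \<Rightarrow> real"
    and \<beta> :: real and d r :: nat
  assumes fin: "finite I" "finite J" and pos: "d > 0" "\<beta> > 0"
    and supp: "\<And>j. j \<in> J \<Longrightarrow> finite (supp j) \<and> supp j \<noteq> {} \<and> card (supp j) \<le> 2"
    and bound: "\<And>j i. j \<in> J \<Longrightarrow> i \<in> I \<Longrightarrow> \<bar>\<Delta> j i\<bar> \<le> int d"
    and drift: "\<And>i. i \<in> I \<Longrightarrow> real_of_int (\<Sum>j\<in>J. \<Delta> j i) = - \<beta> * x i"
    and touch: "\<And>p. real (card {j\<in>J. p \<in> supp j}) \<le> \<beta> * real r"
    and minimal: "\<And>S. S \<subseteq> J \<Longrightarrow> disjoint_family_on supp S \<Longrightarrow>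
      (\<Sum>i\<in>I. \<bar>x i\<bar>) \<le> (\<Sum>i\<in>I. \<bar>x i + real_of_int (\<Sum>j\<in>S. \<Delta> j i)\<bar>)"
  defines "D \<equiv> (2 * d) ^ (2 ^ card I - 1)"
  shows "(\<Sum>i\<in>I. \<bar>x i\<bar>) \<le>
    real (2 * D * card I + (2 * d + 1) ^ card I * (2 * D) * r * d * card I)"
proof -
  have "\<exists>R. finite R \<and> card R \<le> (2 * d + 1) ^ card I * (2 * D) \<and>
      (\<forall>j\<in>J. supp j \<inter> R = {} \<longrightarrow> (\<forall>Q. finite Q \<longrightarrow> card Q \<le> 2 * D \<longrightarrow>
        (\<exists>j'\<in>J. (\<forall>i\<in>I. \<Delta> j' i = \<Delta> j i) \<and> supp j' \<inter> Q = {})))"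
    by (rule rare_values_hitting_set[OF fin(1) bound])
  then obtain R where R: "finite R" "card R \<le> (2 * d + 1) ^ card I * (2 * D)"
    and rare: "\<forall>j\<in>J. supp j \<inter> R = {} \<longrightarrow> (\<forall>Q. finite Q \<longrightarrow> card Q \<le> 2 * D \<longrightarrow>
        (\<exists>j'\<in>J. (\<forall>i\<in>I. \<Delta> j' i = \<Delta> j i) \<and> supp j' \<inter> Q = {}))"
    by (elim exE conjE)
  have common: "\<exists>j'\<in>J. (\<forall>i\<in>I. \<Delta> j' i = \<Delta> j i) \<and> supp j' \<inter> Q = {}"
    if "j \<in> J" "supp j \<inter> R = {}" "finite Q" "card Q \<le> 2 * D" for j Q
    using rare[rule_format, OF that] .
  define V where "V = {j\<in>J. supp j \<inter> R = {}}"
  have V: "V \<subseteq> J" "finite V" using fin by (auto simp: V_def)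
  define Y where "Y i = (\<Sum>j\<in>V. \<Delta> j i)" for i
  have "\<And>j i. j \<in> V \<Longrightarrow> i \<in> I \<Longrightarrow> \<bar>\<Delta> j i\<bar> \<le> int d" using bound V(1) by blast
  then have "\<exists>(P :: ('m + 'i \<times> nat) set set) S n. finite P \<and>
      (\<forall>b\<in>P. S b \<subseteq> V \<and> card (S b) \<le> D \<and>
        (\<forall>i\<in>I. n b i \<le> D \<and> (\<Sum>j\<in>S b. \<Delta> j i) = sgn (Y i) * int (n b i))) \<and>
      (\<forall>i\<in>I. int (\<Sum>b\<in>P. n b i) = \<bar>Y i\<bar>)"
    unfolding D_def Y_def by (intro conformal_decomposition fin(1) V(2) pos(1))
  then obtain P :: "('m + 'i \<times> nat) set set" and S n where P: "finite P" and
    blk: "\<forall>b\<in>P. S b \<subseteq> V \<and> card (S b) \<le> D \<and>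
              (\<forall>i\<in>I. n b i \<le> D \<and> (\<Sum>j\<in>S b. \<Delta> j i) = sgn (Y i) * int (n b i))"
    and total: "\<forall>i\<in>I. int (\<Sum>b\<in>P. n b i) = \<bar>Y i\<bar>"
    by (elim exE conjE)

  \<comment> \<open>\<open>g i\<close> bounds the change of \<open>\<bar>x i\<bar>\<close> per unit
    of \<open>n b i\<close>. It is -1 when \<open>Y i\<close> points against \<open>x i\<close> and
    \<open>\<bar>x i\<bar>\<close> is at least \<open>D\<close>, so that a step of length at most
    \<open>D\<close> cannot cross the origin; otherwise the triangle inequality gives 1.\<close>
  define g :: "'i \<Rightarrow> real"
    where "g i = (if x i \<ge> real D \<and> Y i < 0 \<or> x i \<le> - real D \<and> Y i > 0 then -1 else 1)" for i
  have step: "0 \<le> (\<Sum>i\<in>I. g i * real (n b i))" if "b \<in> P" for b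
  proof -
    have Sb: "S b \<subseteq> V" "card (S b) \<le> D" using blk that by auto
    then have "finite (S b)" using V(2) finite_subset by blast
    moreover have "\<exists>j'\<in>J. (\<forall>i\<in>I. \<Delta> j' i = \<Delta> j i) \<and> supp j' \<inter> Q = {}"
      if "j \<in> S b" "finite Q" "card Q \<le> 2 * D" for j Q
      using common[OF _ _ that(2,3)] Sb(1) that(1) by (auto simp: V_def)
    ultimately have "\<exists>S'\<subseteq>J. finite S' \<and> disjoint_family_on supp S' \<and>
        card (\<Union>(supp ` S')) \<le> 2 * card (S b) \<and>
        (\<forall>i\<in>I. (\<Sum>j\<in>S'. \<Delta> j i) = (\<Sum>j\<in>S b. \<Delta> j i))"
      using Sb(2) supp by (intro disjoint_representatives[where D = D])
    then obtain S' where S': "S' \<subseteq> J" "disjoint_family_on supp S'"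
      "\<forall>i\<in>I. (\<Sum>j\<in>S'. \<Delta> j i) = (\<Sum>j\<in>S b. \<Delta> j i)"
      by blast
    have "(\<Sum>i\<in>I. \<bar>x i\<bar>) \<le> (\<Sum>i\<in>I. \<bar>x i + real_of_int (\<Sum>j\<in>S'. \<Delta> j i)\<bar>)"
      by (rule minimal[OF S'(1,2)])
    also have "\<dots> \<le> (\<Sum>i\<in>I. \<bar>x i\<bar> + g i * real (n b i))"
    proof (rule sum_mono)
      fix i assume i: "i \<in> I"
      have eq: "real_of_int (\<Sum>j\<in>S'. \<Delta> j i) = real_of_int (sgn (Y i)) * real (n b i)"
        using S'(3) blk that i by simp
      have "real (n b i) \<le> real D" using blk that i by simp
      then show "\<bar>x i + real_of_int (\<Sum>j\<in>S'. \<Delta> j i)\<bar> \<le> \<bar>x i\<bar> + g i * real (n b i)"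
        unfolding eq g_def by (cases "Y i" "0::int" rule: linorder_cases) auto
    qed
    finally show ?thesis by (simp add: sum.distrib)
  qed
  have "0 \<le> (\<Sum>b\<in>P. \<Sum>i\<in>I. g i * real (n b i))" by (intro sum_nonneg step)
  also have "\<dots> = (\<Sum>i\<in>I. \<Sum>b\<in>P. g i * real (n b i))" by (rule sum.swap)
  also have "\<dots> = (\<Sum>i\<in>I. g i * \<bar>real_of_int (Y i)\<bar>)"
  proof (intro sum.cong refl)
    fix i assume "i \<in> I"
    have "(\<Sum>b\<in>P. g i * real (n b i)) = g i * real_of_int (int (\<Sum>b\<in>P. n b i))"
      by (simp add: sum_distrib_left)
    also have "int (\<Sum>b\<in>P. n b i) = \<bar>Y i\<bar>" using total \<open>i \<in> I\<close> by blast
    finally show "(\<Sum>b\<in>P. g i * real (n b i)) = g i * \<bar>real_of_int (Y i)\<bar>" by simp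
  qed
  finally have gain: "0 \<le> (\<Sum>i\<in>I. g i * \<bar>real_of_int (Y i)\<bar>)" .

  define e where "e i = (\<Sum>j\<in>J - V. \<Delta> j i)" for i
  have Y_eq: "real_of_int (Y i) = - \<beta> * x i - real_of_int (e i)" if "i \<in> I" for i
    using drift[OF that] sum.subset_diff[OF V(1) fin(2), of "\<lambda>j. \<Delta> j i"]
    by (simp add: Y_def e_def)
  \<comment> \<open>\<open>\<beta> * E\<close> bounds the drift lost to moves meeting
    \<open>R\<close>: each point of \<open>R\<close> is touched by at most
    \<open>\<beta> * r\<close> moves, and each of them changes a coordinate by at most
    \<open>d\<close>.\<close>
  define E where "E = real ((2 * d + 1) ^ card I * (2 * D) * r * d)"
  have "real (card (J - V)) \<le> real (card R) * (\<beta> * real r)"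
  proof -
    have "card (J - V) \<le> card (\<Union>p\<in>R. {j\<in>J. p \<in> supp j})"
      using fin R by (intro card_mono) (auto simp: V_def)
    also have "\<dots> \<le> (\<Sum>p\<in>R. card {j\<in>J. p \<in> supp j})" by (rule card_UN_le[OF R(1)])
    finally have "real (card (J - V)) \<le> (\<Sum>p\<in>R. real (card {j\<in>J. p \<in> supp j}))"
      by (simp flip: of_nat_sum)
    also have "\<dots> \<le> real (card R) * (\<beta> * real r)"
      using touch by (intro sum_bounded_above)
    finally show ?thesis .
  qed
  also have "\<dots> \<le> real ((2 * d + 1) ^ card I * (2 * D)) * (\<beta> * real r)"
    using R(2) pos by (intro mult_right_mono) (simp_all flip: of_nat_mult of_nat_power)
  finally have "real (card (J - V)) * real d \<le>
      real ((2 * d + 1) ^ card I * (2 * D)) * (\<beta> * real r) * real d"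
    by (rule mult_right_mono) simp
  also have "\<dots> = \<beta> * E" by (simp add: E_def)
  finally have card_rare: "real (card (J - V)) * real d \<le> \<beta> * E" .
  have e_bound: "\<bar>real_of_int (e i)\<bar> \<le> \<beta> * E" if "i \<in> I" for i
  proof -
    have "\<bar>e i\<bar> \<le> (\<Sum>j\<in>J - V. \<bar>\<Delta> j i\<bar>)" unfolding e_def by (rule sum_abs)
    also have "\<dots> \<le> int (card (J - V)) * int d"
      using bound that by (intro sum_bounded_above) auto
    finally have "real_of_int \<bar>e i\<bar> \<le> real_of_int (int (card (J - V)) * int d)"
      by (simp only: of_int_le_iff)
    then show ?thesis using card_rare by simp
  qed
  \<comment> \<open>The term \<open>2 * (\<beta> * D)\<close> pays for
    \<open>\<bar>x i\<bar> \<le> D\<close>, where \<open>\<bar>Y i\<bar>\<close> can reach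
    \<open>\<beta> * D + \<beta> * E\<close>. If \<open>\<bar>x i\<bar> > D\<close> but
    \<open>g i = 1\<close>, then \<open>Y i\<close> does not point against \<open>x i\<close>, and
    the error \<open>\<bar>e i\<bar>\<close> equals
    \<open>\<beta> * \<bar>x i\<bar> + \<bar>Y i\<bar>\<close>.\<close>
  have "\<beta> * \<bar>x i\<bar> \<le> - (g i * \<bar>real_of_int (Y i)\<bar>) + (2 * (\<beta> * real D) + \<beta> * E)" if "i \<in> I" for i
  proof -
    have ab: "\<bar>\<beta> * x i\<bar> = \<beta> * \<bar>x i\<bar>" using pos(2) by (simp add: abs_mult)
    have D0: "\<beta> * real D \<ge> 0" using pos(2) by simp
    have small: "\<beta> * \<bar>x i\<bar> \<le> \<beta> * real D" if "\<bar>x i\<bar> \<le> real D"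
      using that pos(2) by simp
    show ?thesis
    proof (cases "g i = -1")
      case True
      then show ?thesis using Y_eq[OF that] e_bound[OF that] ab D0 by simp
    next
      case False
      then have "g i = 1" by (auto simp: g_def split: if_splits)
      consider "\<bar>x i\<bar> \<le> real D" | "x i > real D" "Y i \<ge> 0" | "x i < - real D" "Y i \<le> 0"
      proof -
        have "\<not> (x i > real D \<and> Y i < 0)" "\<not> (x i < - real D \<and> Y i > 0)"
          using False by (auto simp: g_def)
        then show ?thesis using that by linarith
      qed
      then show ?thesis
      proof cases
        case 1
        then show ?thesis
          using small Y_eq[OF that] e_bound[OF that] ab \<open>g i = 1\<close> by simp
      next
        case 2
        then have "real_of_int (Y i) \<ge> 0" "\<beta> * x i \<ge> 0" using pos(2) by auto
        then show ?thesis
          using Y_eq[OF that] e_bound[OF that] ab \<open>g i = 1\<close> D0 by simp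
      next
        case 3
        then have "real_of_int (Y i) \<le> 0" "\<beta> * x i \<le> 0"
          using pos(2) by (auto simp: mult_le_0_iff)
        then show ?thesis
          using Y_eq[OF that] e_bound[OF that] ab \<open>g i = 1\<close> D0 by simp
      qed
    qed
  qed
  then have "(\<Sum>i\<in>I. \<beta> * \<bar>x i\<bar>) \<le>
      (\<Sum>i\<in>I. - (g i * \<bar>real_of_int (Y i)\<bar>) + (2 * (\<beta> * real D) + \<beta> * E))"
    by (rule sum_mono)
  also have "\<dots> \<le> real (card I) * (2 * (\<beta> * real D) + \<beta> * E)"
    using gain by (simp only: sum.distrib sum_negf sum_constant distrib_left)
  finally have "\<beta> * (\<Sum>i\<in>I. \<bar>x i\<bar>) \<le> \<beta> * (real (card I) * (2 * real D + E))"
    by (simp add: sum_distrib_left algebra_simps)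
  then have "(\<Sum>i\<in>I. \<bar>x i\<bar>) \<le> real (card I) * (2 * real D + E)"
    using pos(2) by simp
  then show ?thesis by (simp add: E_def algebra_simps)
qed

section \<open>Rearranging vertices\<close>

text \<open>
  A factor of the complete graph on \<open>{..<N}\<close> is encoded by a permutation \<open>\<sigma>\<close>: position \<open>p\<close> is
  occupied by the vertex \<open>\<sigma> p\<close> and lies in the block \<open>p div r\<close>, and \<open>G\<close> is the set of adjacent ordered
  pairs of positions. Every edge is therefore counted twice.
\<close>

definition pair_count :: "(nat set \<Rightarrow> nat) \<Rightarrow> (nat \<times> nat) set \<Rightarrow> (nat \<Rightarrow> nat) \<Rightarrow> nat \<Rightarrow> int" where
  "pair_count c G \<sigma> i = (\<Sum>(p, q)\<in>G. of_bool (c {\<sigma> p, \<sigma> q} = i))"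

text \<open>A pair of \<open>G\<close> lies within one block. If that block is in \<open>A\<close>,
  then \<open>\<rho>\<close> fixes its points and their images under \<open>\<tau>\<close>;
  otherwise \<open>\<tau>\<close> fixes its points. So each pair feels at most one of the two
  rearrangements, and the changes add.\<close>

lemma pair_count_comp:
  assumes "\<And>p q. (p, q) \<in> G \<Longrightarrow> blk q = blk p"
    and "\<And>p. blk p \<notin> A \<Longrightarrow> \<tau> p = p"
    and "\<And>p. blk p \<in> A \<Longrightarrow> blk (\<tau> p) \<in> A"
    and "\<And>p. blk p \<in> A \<Longrightarrow> \<rho> p = p"
  shows "pair_count c G (\<sigma> \<circ> (\<rho> \<circ> \<tau>)) i =
    pair_count c G (\<sigma> \<circ> \<rho>) i + (pair_count c G (\<sigma> \<circ> \<tau>) i - pair_count c G \<sigma> i)"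
proof -
  define h where "h s x = (of_bool (c {s (fst x), s (snd x)} = i) :: int)" for s :: "nat \<Rightarrow> nat" and x
  have pc: "pair_count c G s i = sum (h s) G" for s
    by (simp add: pair_count_def h_def case_prod_beta)
  have "h (\<sigma> \<circ> (\<rho> \<circ> \<tau>)) x = h (\<sigma> \<circ> \<rho>) x + (h (\<sigma> \<circ> \<tau>) x - h \<sigma> x)" if "x \<in> G" for x
  proof -
    obtain p q where x: "x = (p, q)" by (cases x)
    then have blk: "blk q = blk p" using assms(1) that by simp
    show ?thesis
    proof (cases "blk p \<in> A")
      case True
      then have "\<rho> p = p" "\<rho> q = q" "\<rho> (\<tau> p) = \<tau> p" "\<rho> (\<tau> q) = \<tau> q"
        using assms(3,4) blk by auto
      then show ?thesis by (simp add: h_def x)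
    next
      case False
      then have "\<tau> p = p" "\<tau> q = q" using assms(2) blk by auto
      then show ?thesis by (simp add: h_def x)
    qed
  qed
  then have "sum (h (\<sigma> \<circ> (\<rho> \<circ> \<tau>))) G = (\<Sum>x\<in>G. h (\<sigma> \<circ> \<rho>) x + (h (\<sigma> \<circ> \<tau>) x - h \<sigma> x))"
    by (rule sum.cong[OF refl])
  then show ?thesis by (simp only: pc sum.distrib sum_subtractf)
qed

text \<open>The induction also records that \<open>\<rho>\<close> fixes all blocks not yet used,
  which \<open>pair_count_comp\<close> needs for the next move. \<open>M\<close> stands for the
  admissible rearrangements: all permutations of the positions in the clique stage, the
  block-preserving ones in the placement stage.\<close>

lemma disjoint_moves_compose:
  assumes local: "\<And>p q. (p, q) \<in> G \<Longrightarrow> blk q = blk p"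
    and fixes_outside: "\<And>j p. j \<in> J \<Longrightarrow> blk p \<notin> supp j \<Longrightarrow> \<tau> j p = p"
    and maps_inside: "\<And>j p. j \<in> J \<Longrightarrow> blk p \<in> supp j \<Longrightarrow> blk (\<tau> j p) \<in> supp j"
    and closed: "id \<in> M" "\<And>j \<rho>. j \<in> J \<Longrightarrow> \<rho> \<in> M \<Longrightarrow> \<rho> \<circ> \<tau> j \<in> M"
    and S: "finite S" "S \<subseteq> J" "disjoint_family_on supp S"
  shows "\<exists>\<rho>\<in>M. (\<forall>p. blk p \<notin> \<Union>(supp ` S) \<longrightarrow> \<rho> p = p) \<and>
    (\<forall>i. pair_count c G (\<sigma> \<circ> \<rho>) i =
       pair_count c G \<sigma> i + (\<Sum>j\<in>S. pair_count c G (\<sigma> \<circ> \<tau> j) i - pair_count c G \<sigma> i))"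
  using S
proof (induction S rule: finite_induct)
  case empty
  then show ?case using closed(1) by (intro bexI[of _ id]) auto
next
  case (insert j S)
  have "disjoint_family_on supp S"
    using insert.prems(2) by (auto simp: disjoint_family_on_def)
  moreover have "S \<subseteq> J" using insert.prems(1) by simp
  ultimately obtain \<rho> where \<rho>: "\<rho> \<in> M" "\<forall>p. blk p \<notin> \<Union>(supp ` S) \<longrightarrow> \<rho> p = p"
    "\<forall>i. pair_count c G (\<sigma> \<circ> \<rho>) i =
       pair_count c G \<sigma> i + (\<Sum>j\<in>S. pair_count c G (\<sigma> \<circ> \<tau> j) i - pair_count c G \<sigma> i)"
    using insert.IH by blast
  have j: "j \<in> J" using insert.prems by simp
  have "supp j \<inter> supp j' = {}" if "j' \<in> S" for j'
  proof -
    have "j \<noteq> j'" using that insert.hyps(2) by auto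
    then show ?thesis using insert.prems(2) that by (simp add: disjoint_family_on_def)
  qed
  then have "\<rho> p = p" if "blk p \<in> supp j" for p using \<rho>(2) that by auto
  then have step: "pair_count c G (\<sigma> \<circ> (\<rho> \<circ> \<tau> j)) i =
      pair_count c G (\<sigma> \<circ> \<rho>) i + (pair_count c G (\<sigma> \<circ> \<tau> j) i - pair_count c G \<sigma> i)" for i
    using local fixes_outside[OF j] maps_inside[OF j] by (intro pair_count_comp[where A = "supp j" and blk = blk]) auto
  have "pair_count c G (\<sigma> \<circ> (\<rho> \<circ> \<tau> j)) i =
      pair_count c G \<sigma> i + (\<Sum>j\<in>insert j S. pair_count c G (\<sigma> \<circ> \<tau> j) i - pair_count c G \<sigma> i)" for i
    unfolding sum.insert[OF insert.hyps(1,2)] using step[of i] \<rho>(3)[rule_format, of i] by linarith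
  moreover have "(\<rho> \<circ> \<tau> j) p = p" if "blk p \<notin> \<Union>(supp ` insert j S)" for p
    using that fixes_outside[OF j, of p] \<rho>(2) by auto
  moreover have "\<rho> \<circ> \<tau> j \<in> M" using closed(2)[OF j \<rho>(1)] .
  ultimately show ?case by blast
qed

lemma pair_count_change_le:
  assumes "finite G" and local: "\<And>p q. (p, q) \<in> G \<Longrightarrow> blk q = blk p"
    and "finite A" and fixes_outside: "\<And>p. blk p \<notin> A \<Longrightarrow> \<tau> p = p"
    and size: "\<And>a. card {(p, q)\<in>G. blk p = a} \<le> s"
  shows "\<bar>pair_count c G (\<sigma> \<circ> \<tau>) i - pair_count c G \<sigma> i\<bar> \<le> int (card A * s)"
proof -
  define f where "f s x = (of_bool (c {s (fst x), s (snd x)} = i) :: int)" for s :: "nat \<Rightarrow> nat" and x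
  have "\<bar>pair_count c G (\<sigma> \<circ> \<tau>) i - pair_count c G \<sigma> i\<bar> = \<bar>\<Sum>x\<in>G. f (\<sigma> \<circ> \<tau>) x - f \<sigma> x\<bar>"
    by (simp add: pair_count_def f_def sum_subtractf case_prod_beta)
  also have "\<dots> \<le> (\<Sum>x\<in>G. \<bar>f (\<sigma> \<circ> \<tau>) x - f \<sigma> x\<bar>)" by (rule sum_abs)
  also have "\<dots> \<le> (\<Sum>x\<in>G. of_bool (blk (fst x) \<in> A))"
  proof (rule sum_mono)
    fix x assume x: "x \<in> G"
    obtain p q where pq: "x = (p, q)" by (cases x)
    then have "blk q = blk p" using local x by simp
    then show "\<bar>f (\<sigma> \<circ> \<tau>) x - f \<sigma> x\<bar> \<le> of_bool (blk (fst x) \<in> A)"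
      using fixes_outside[of p] fixes_outside[of q] by (cases "blk p \<in> A") (auto simp: f_def pq)
  qed
  also have "\<dots> = int (card {x\<in>G. blk (fst x) \<in> A})"
    using assms(1) by (simp add: Int_def)
  also have "{x\<in>G. blk (fst x) \<in> A} = (\<Union>a\<in>A. {(p, q)\<in>G. blk p = a})" by auto
  also have "int (card \<dots>) \<le> int (\<Sum>a\<in>A. card {(p, q)\<in>G. blk p = a})"
    using card_UN_le[OF assms(3), of "\<lambda>a. {(p, q)\<in>G. blk p = a}"] by (simp only: of_nat_le_iff)
  also have "\<dots> \<le> int (card A * s)"
    using sum_bounded_above[of A "\<lambda>a. card {(p, q)\<in>G. blk p = a}" s] size
    by (simp only: of_nat_le_iff of_nat_id)
  finally show ?thesis .
qed

text \<open>The value of the bound in \<open>drift_bound\<close> for \<open>k\<close> colours. Here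
  \<open>d = 2 * r\<^sup>2\<close> because a move touches at most two blocks, each with at most
  \<open>r\<^sup>2\<close> ordered pairs; \<open>D\<close> is the block size from
  \<open>zero_sum_partition\<close>.\<close>

definition discr_bound :: "nat \<Rightarrow> nat \<Rightarrow> nat" where
  "discr_bound k r = (let d = 2 * r\<^sup>2; D = (2 * d) ^ (2 ^ k - 1) in
     2 * D * k + (2 * d + 1) ^ k * (2 * D) * r * d * k)"

text \<open>The common core of both stages, which differ in the moves (transpositions of positions,
  permutations of one block), in the target \<open>\<mu>\<close> and in \<open>M\<close>. Locality
  of \<open>G\<close> makes disjoint moves additive, so that minimality over \<open>M\<close> yields
  the minimality required by \<open>drift_bound\<close>.\<close>

lemma local_minimum_bound:
  fixes blk :: "nat \<Rightarrow> 'p" and supp :: "'j \<Rightarrow> 'p set" and \<mu> :: "nat \<Rightarrow> real"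
  assumes fin: "finite G" "finite J" "finite I" and pos: "r > 0" "\<beta> > 0"
    and local: "\<And>p q. (p, q) \<in> G \<Longrightarrow> blk q = blk p"
    and size: "\<And>a. card {(p, q)\<in>G. blk p = a} \<le> r\<^sup>2"
    and supp: "\<And>j. j \<in> J \<Longrightarrow> finite (supp j) \<and> supp j \<noteq> {} \<and> card (supp j) \<le> 2"
    and fixes_outside: "\<And>j p. j \<in> J \<Longrightarrow> blk p \<notin> supp j \<Longrightarrow> \<tau> j p = p"
    and maps_inside: "\<And>j p. j \<in> J \<Longrightarrow> blk p \<in> supp j \<Longrightarrow> blk (\<tau> j p) \<in> supp j"
    and closed: "id \<in> M" "\<And>j \<rho>. j \<in> J \<Longrightarrow> \<rho> \<in> M \<Longrightarrow> \<rho> \<circ> \<tau> j \<in> M"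
    and touch: "\<And>a. real (card {j\<in>J. a \<in> supp j}) \<le> \<beta> * real r"
    and drift: "\<And>i. i \<in> I \<Longrightarrow>
      real_of_int (\<Sum>j\<in>J. pair_count c G (\<sigma> \<circ> \<tau> j) i - pair_count c G \<sigma> i) =
      - \<beta> * (real_of_int (pair_count c G \<sigma> i) - \<mu> i)"
    and minimal: "\<And>\<rho>. \<rho> \<in> M \<Longrightarrow> (\<Sum>i\<in>I. \<bar>real_of_int (pair_count c G \<sigma> i) - \<mu> i\<bar>) \<le>
      (\<Sum>i\<in>I. \<bar>real_of_int (pair_count c G (\<sigma> \<circ> \<rho>) i) - \<mu> i\<bar>)"
  shows "(\<Sum>i\<in>I. \<bar>real_of_int (pair_count c G \<sigma> i) - \<mu> i\<bar>) \<le> real (discr_bound (card I) r)"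
proof -
  have bound: "\<bar>pair_count c G (\<sigma> \<circ> \<tau> j) i - pair_count c G \<sigma> i\<bar> \<le> int (2 * r\<^sup>2)" if "j \<in> J" for j i
  proof -
    have "\<bar>pair_count c G (\<sigma> \<circ> \<tau> j) i - pair_count c G \<sigma> i\<bar> \<le> int (card (supp j) * r\<^sup>2)"
      using fin(1) local supp[OF that] fixes_outside[OF that] size
      by (intro pair_count_change_le[where blk = blk]) auto
    also have "\<dots> \<le> int (2 * r\<^sup>2)"
      using supp[OF that] by (simp only: of_nat_le_iff mult_le_mono1)
    finally show ?thesis .
  qed
  have min_S: "(\<Sum>i\<in>I. \<bar>real_of_int (pair_count c G \<sigma> i) - \<mu> i\<bar>) \<le>
      (\<Sum>i\<in>I. \<bar>(real_of_int (pair_count c G \<sigma> i) - \<mu> i) +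
         real_of_int (\<Sum>j\<in>S. pair_count c G (\<sigma> \<circ> \<tau> j) i - pair_count c G \<sigma> i)\<bar>)"
    if S: "S \<subseteq> J" "disjoint_family_on supp S" for S
  proof -
    have "finite S" using S fin(2) finite_subset by blast
    from disjoint_moves_compose[where G = G and blk = blk and J = J and supp = supp and \<tau> = \<tau>
        and M = M and c = c and \<sigma> = \<sigma>, OF local fixes_outside maps_inside closed this S]
    obtain \<rho> where \<rho>: "\<rho> \<in> M" "\<And>i. pair_count c G (\<sigma> \<circ> \<rho>) i =
       pair_count c G \<sigma> i + (\<Sum>j\<in>S. pair_count c G (\<sigma> \<circ> \<tau> j) i - pair_count c G \<sigma> i)"
      by blast
    show ?thesis using minimal[OF \<rho>(1)] unfolding \<rho>(2) by (simp add: algebra_simps)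
  qed
  have "2 * r\<^sup>2 > 0" using pos(1) by simp
  from drift_bound[where I = I and J = J and supp = supp and d = "2 * r\<^sup>2" and r = r and \<beta> = \<beta>
      and \<Delta> = "\<lambda>j i. pair_count c G (\<sigma> \<circ> \<tau> j) i - pair_count c G \<sigma> i"
      and x = "\<lambda>i. real_of_int (pair_count c G \<sigma> i) - \<mu> i",
      OF fin(3,2) this pos(2) supp bound drift touch min_S]
  show ?thesis unfolding discr_bound_def Let_def .
qed

section \<open>Balanced clique factors\<close>

definition block_graph :: "nat \<Rightarrow> nat \<Rightarrow> (nat \<times> nat) set" where
  "block_graph r N = {(p, q). p < N \<and> q < N \<and> p \<noteq> q \<and> p div r = q div r}"

lemma div_eq_iff_block: "r > 0 \<Longrightarrow> p div r = a \<longleftrightarrow> p \<in> {a * r..<a * r + r}" for p r a :: nat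
  by (auto simp: div_nat_eqI mult.commute dividend_less_times_div add.commute
      intro!: div_nat_eqI)

lemma finite_block_graph: "finite (block_graph r N)"
  by (rule finite_subset[of _ "{..<N} \<times> {..<N}"]) (auto simp: block_graph_def)

lemma block_graph_size:
  assumes "r > 0" shows "card {(p, q)\<in>block_graph r N. p div r = a} \<le> r\<^sup>2"
proof -
  have "card {(p, q)\<in>block_graph r N. p div r = a} \<le> card ({a * r..<a * r + r} \<times> {a * r..<a * r + r})"
  proof (rule card_mono)
    show "{(p, q)\<in>block_graph r N. p div r = a} \<subseteq> {a * r..<a * r + r} \<times> {a * r..<a * r + r}"
      unfolding block_graph_def div_eq_iff_block[OF assms, symmetric] set_eq_iff
      by (auto simp: div_eq_iff_block[OF assms, symmetric] simp del: atLeastLessThan_iff)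
  qed simp
  then show ?thesis by (simp add: card_cartesian_product power2_eq_square)
qed

text \<open>Since \<open>r\<close> divides \<open>N\<close>, there is no truncated last block; this
  is the regularity needed for the transposition drift.\<close>

lemma block_graph_degree:
  assumes "r > 0" "N = m * r" "p < N"
  shows "card {q. (p, q) \<in> block_graph r N} = r - 1"
proof -
  define a where "a = p div r"
  have "a < m" using assms by (simp add: a_def less_mult_imp_div_less)
  then have "Suc a * r \<le> N" using assms(2) by (metis Suc_leI mult_le_mono1)
  then have "q < N" if "q \<in> {a * r..<a * r + r}" for q using that by simp
  then have "{q. (p, q) \<in> block_graph r N} = {a * r..<a * r + r} - {p}"
    using assms(3) unfolding block_graph_def
    by (auto simp: div_eq_iff_block[OF assms(1), symmetric] a_def simp del: atLeastLessThan_iff)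
  moreover have "p \<in> {a * r..<a * r + r}"
    using div_eq_iff_block[OF assms(1)] a_def by blast
  ultimately show ?thesis by simp
qed

lemma pair_count_reindex:
  assumes "bij_betw (map_prod \<rho> \<rho>) G G"
  shows "pair_count c G (\<sigma> \<circ> \<rho>) i = pair_count c G \<sigma> i"
proof -
  define f where "f = (\<lambda>x. (of_bool (c {\<sigma> (fst x), \<sigma> (snd x)} = i) :: int))"
  have "pair_count c G (\<sigma> \<circ> \<rho>) i = (\<Sum>x\<in>G. f (map_prod \<rho> \<rho> x))"
    by (simp add: pair_count_def f_def case_prod_beta)
  also have "\<dots> = sum f G" by (rule sum.reindex_bij_betw[OF assms])
  finally show ?thesis by (simp add: pair_count_def f_def case_prod_beta)
qed

lemma bij_betw_map_prod:
  assumes "\<rho> permutes V" "finite G" "\<And>p q. (p, q) \<in> G \<Longrightarrow> (\<rho> p, \<rho> q) \<in> G"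
  shows "bij_betw (map_prod \<rho> \<rho>) G G"
proof -
  have "inj_on (map_prod \<rho> \<rho>) G"
    using permutes_inj[OF assms(1)] by (auto simp: inj_on_def)
  moreover have "map_prod \<rho> \<rho> ` G \<subseteq> G" using assms(3) by auto
  ultimately show ?thesis using assms(2) by (simp add: bij_betw_def endo_inj_surj)
qed

text \<open>A transposition affects the value at \<open>{a, b}\<close> only if exactly one of
  \<open>a\<close>, \<open>b\<close> is moved, because \<open>w\<close> is symmetric. There are four
  ways to match \<open>p\<close> or \<open>q\<close> with \<open>a\<close> or \<open>b\<close>. Each
  replaces one end by an arbitrary vertex, giving a degree sum, and subtracts \<open>w a b\<close>
  once for each of \<open>card V - 1\<close> choices.\<close>

lemma transposition_sum:
  fixes w :: "'a \<Rightarrow> 'a \<Rightarrow> int"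
  assumes "finite V" "a \<in> V" "b \<in> V" "a \<noteq> b" and sym: "\<And>u v. w u v = w v u"
  shows "(\<Sum>(p, q)\<in>V \<times> V. w (transpose p q a) (transpose p q b) - w a b) =
    2 * ((\<Sum>q\<in>V - {a}. w a q) + (\<Sum>q\<in>V - {b}. w b q)) - 4 * (int (card V) - 1) * w a b"
proof -
  have row: "(\<Sum>p\<in>V. \<Sum>q\<in>V. of_bool (p = x \<and> q \<noteq> y) * f q) = (\<Sum>q\<in>V - {y}. f q)"
    if "x \<in> V" for x y and f :: "'a \<Rightarrow> int"
  proof -
    have "(\<Sum>p\<in>V. \<Sum>q\<in>V. of_bool (p = x \<and> q \<noteq> y) * f q) =
        (\<Sum>p\<in>V. if p = x then \<Sum>q\<in>V. of_bool (q \<noteq> y) * f q else 0)"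
      by (intro sum.cong) auto
    also have "\<dots> = (\<Sum>q\<in>V. of_bool (q \<noteq> y) * f q)" using that assms(1) by simp
    also have "\<dots> = (\<Sum>q\<in>V - {y}. f q)"
      using assms(1) by (intro sum.mono_neutral_cong_right) auto
    finally show ?thesis .
  qed
  have col: "(\<Sum>p\<in>V. \<Sum>q\<in>V. of_bool (q = x \<and> p \<noteq> y) * f p) = (\<Sum>q\<in>V - {y}. f q)"
    if "x \<in> V" for x y and f :: "'a \<Rightarrow> int"
    using row[OF that, of y f] sum.swap[of "\<lambda>p q. of_bool (q = x \<and> p \<noteq> y) * f p" V V] by simp
  \<comment> \<open>The cases \<open>p = q\<close> are kept: their terms vanish, and each sum then
    runs over all of \<open>V\<close> except a single vertex.\<close>
  have pointwise: "w (transpose p q a) (transpose p q b) - w a b =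
      of_bool (p = a \<and> q \<noteq> b) * (w q b - w a b) + of_bool (q = a \<and> p \<noteq> b) * (w p b - w a b) +
      of_bool (p = b \<and> q \<noteq> a) * (w a q - w a b) + of_bool (q = b \<and> p \<noteq> a) * (w a p - w a b)" for p q
    using assms(4) sym[of b a]
    by (cases "p = a"; cases "p = b"; cases "q = a"; cases "q = b") (simp_all add: transpose_def)
  have "(\<Sum>(p, q)\<in>V \<times> V. w (transpose p q a) (transpose p q b) - w a b) =
      (\<Sum>p\<in>V. \<Sum>q\<in>V. w (transpose p q a) (transpose p q b) - w a b)"
    by (simp add: sum.cartesian_product)
  also have "\<dots> = (\<Sum>p\<in>V. \<Sum>q\<in>V.
      of_bool (p = a \<and> q \<noteq> b) * (w q b - w a b) + of_bool (q = a \<and> p \<noteq> b) * (w p b - w a b) +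
      of_bool (p = b \<and> q \<noteq> a) * (w a q - w a b) + of_bool (q = b \<and> p \<noteq> a) * (w a p - w a b))"
    by (simp only: pointwise)
  also have "\<dots> = 2 * (\<Sum>q\<in>V - {b}. w q b - w a b) + 2 * (\<Sum>q\<in>V - {a}. w a q - w a b)"
    by (simp only: sum.distrib row[OF assms(2)] row[OF assms(3)] col[OF assms(2)] col[OF assms(3)])
  also have "\<dots> = 2 * ((\<Sum>q\<in>V - {a}. w a q) + (\<Sum>q\<in>V - {b}. w b q)) - 4 * (int (card V) - 1) * w a b"
  proof -
    have "card V > 0" using assms(1,2) by (auto simp: card_gt_0_iff)
    moreover have "(\<Sum>q\<in>V - {b}. w q b) = (\<Sum>q\<in>V - {b}. w b q)" by (intro sum.cong refl sym)
    ultimately show ?thesis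
      using assms(1-3) by (simp add: sum_subtractf of_nat_diff algebra_simps)
  qed
  finally show ?thesis .
qed

text \<open>
  Regularity of \<open>G\<close> makes the vertex degrees in colour \<open>i\<close> contribute a constant, so the deviation
  from the mean is an eigenfunction of the random transposition walk.
\<close>

lemma transposition_drift:
  assumes "finite V" "\<sigma> permutes V" and G: "G \<subseteq> {(p, q). p \<in> V \<and> q \<in> V \<and> p \<noteq> q}"
    and sym: "\<And>p q. (p, q) \<in> G \<Longrightarrow> (q, p) \<in> G"
    and deg: "\<And>p. p \<in> V \<Longrightarrow> card {q. (p, q) \<in> G} = s"
  shows "(\<Sum>(p, q)\<in>V \<times> V. pair_count c G (\<sigma> \<circ> transpose p q) i - pair_count c G \<sigma> i) =
    4 * (int s * pair_count c {(p, q). p \<in> V \<and> q \<in> V \<and> p \<noteq> q} id i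
       - (int (card V) - 1) * pair_count c G \<sigma> i)"
proof -
  define w where "w u v = (of_bool (c {\<sigma> u, \<sigma> v} = i) :: int)" for u v
  have w_sym: "w u v = w v u" for u v by (simp add: w_def insert_commute)
  have finG: "finite G" using G assms(1) by (auto intro: finite_subset[of _ "V \<times> V"])
  define deg_w where "deg_w a = (\<Sum>q\<in>V - {a}. w a q)" for a
  have G_Sigma: "G = (SIGMA p:V. {q. (p, q) \<in> G})" using G by auto
  have fin_nb: "finite {q. (p, q) \<in> G}" for p
    using G assms(1) by (auto intro: finite_subset[of _ V])
  have deg_sum: "(\<Sum>(a, b)\<in>G. deg_w a) = int s * (\<Sum>a\<in>V. deg_w a)"
  proof -
    have "(\<Sum>(a, b)\<in>G. deg_w a) = (\<Sum>a\<in>V. \<Sum>b\<in>{q. (a, q) \<in> G}. deg_w a)"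
      by (subst G_Sigma, subst sum.Sigma) (use assms(1) fin_nb in auto)
    also have "\<dots> = int s * (\<Sum>a\<in>V. deg_w a)" using deg by (simp add: sum_distrib_left)
    finally show ?thesis .
  qed
  have swap_sum: "(\<Sum>(a, b)\<in>G. deg_w b) = (\<Sum>(a, b)\<in>G. deg_w a)"
    by (rule sum.reindex_bij_witness[of _ prod.swap prod.swap]) (auto dest: sym)
  \<comment> \<open>\<open>\<sigma>\<close> permutes the ordered pairs of distinct vertices, so the
    overall count of a colour does not depend on the arrangement.\<close>
  have total: "(\<Sum>a\<in>V. deg_w a) = pair_count c {(p, q). p \<in> V \<and> q \<in> V \<and> p \<noteq> q} id i"
  proof -
    let ?O = "{(p, q). p \<in> V \<and> q \<in> V \<and> p \<noteq> q}"
    have "?O = (SIGMA a:V. V - {a})" by auto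
    moreover have "(\<Sum>a\<in>V. deg_w a) = (\<Sum>(a, q)\<in>(SIGMA a:V. V - {a}). w a q)"
      unfolding deg_w_def using assms(1) by (intro sum.Sigma) auto
    ultimately have "(\<Sum>a\<in>V. deg_w a) = pair_count c ?O \<sigma> i"
      by (simp only: pair_count_def w_def)
    moreover have "bij_betw (map_prod \<sigma> \<sigma>) ?O ?O"
      using assms(2) permutes_inj[OF assms(2)] finite_subset[of ?O "V \<times> V"] assms(1)
      by (intro bij_betw_map_prod) (auto simp: permutes_in_image inj_eq)
    ultimately show ?thesis using pair_count_reindex[of \<sigma> ?O c id i] by simp
  qed
  have pc: "pair_count c G (\<sigma> \<circ> \<tau>) i = (\<Sum>(a, b)\<in>G. w (\<tau> a) (\<tau> b))" for \<tau>
    by (simp add: pair_count_def w_def)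
  have pc0: "pair_count c G \<sigma> i = (\<Sum>(a, b)\<in>G. w a b)" by (simp add: pair_count_def w_def)
  have "(\<Sum>(p, q)\<in>V \<times> V. pair_count c G (\<sigma> \<circ> transpose p q) i - pair_count c G \<sigma> i) =
      (\<Sum>x\<in>V \<times> V. \<Sum>y\<in>G. w (transpose (fst x) (snd x) (fst y)) (transpose (fst x) (snd x) (snd y))
        - w (fst y) (snd y))"
    unfolding pc pc0 by (simp add: sum_subtractf case_prod_beta)
  also have "\<dots> = (\<Sum>y\<in>G. \<Sum>x\<in>V \<times> V.
      w (transpose (fst x) (snd x) (fst y)) (transpose (fst x) (snd x) (snd y)) - w (fst y) (snd y))"
    by (rule sum.swap)
  also have "\<dots> = (\<Sum>y\<in>G. 2 * (deg_w (fst y) + deg_w (snd y)) - 4 * (int (card V) - 1) * w (fst y) (snd y))"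
  proof (intro sum.cong refl)
    fix y assume "y \<in> G"
    then have "fst y \<in> V" "snd y \<in> V" "fst y \<noteq> snd y" using G by auto
    from transposition_sum[of V, OF assms(1) this, of w, OF w_sym]
    show "(\<Sum>x\<in>V \<times> V. w (transpose (fst x) (snd x) (fst y)) (transpose (fst x) (snd x) (snd y))
        - w (fst y) (snd y)) = 2 * (deg_w (fst y) + deg_w (snd y)) - 4 * (int (card V) - 1) * w (fst y) (snd y)"
      by (simp add: case_prod_beta deg_w_def)
  qed
  also have "\<dots> = 2 * ((\<Sum>(a, b)\<in>G. deg_w a) + (\<Sum>(a, b)\<in>G. deg_w b))
      - 4 * (int (card V) - 1) * pair_count c G \<sigma> i"
    by (simp add: pc0 sum_subtractf sum.distrib sum_distrib_left case_prod_beta)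
  also have "\<dots> = 4 * (int s * pair_count c {(p, q). p \<in> V \<and> q \<in> V \<and> p \<noteq> q} id i
       - (int (card V) - 1) * pair_count c G \<sigma> i)"
    unfolding swap_sum deg_sum total by (simp add: algebra_simps)
  finally show ?thesis .
qed

lemma finite_minimiser:
  fixes f :: "'a \<Rightarrow> real"
  assumes "finite M" "M \<noteq> {}"
  obtains x where "x \<in> M" "\<And>y. y \<in> M \<Longrightarrow> f x \<le> f y"
  using arg_min_if_finite[OF assms, of f] by (meson not_le)

text \<open>Balancedness enters through \<open>bal\<close>: it makes the constant part of the drift
  equal to \<open>4 * (N - 1)\<close> times \<open>(r - 1) * N / k\<close>. The drift therefore
  vanishes exactly where the \<open>N * (r - 1)\<close> ordered pairs inside the blocks are shared
  equally among the colours.\<close>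

lemma balanced_clique_factor:
  assumes "r \<ge> 2" "N = m * r" "m > 0" "k > 0"
    and bal: "\<And>i. i \<in> {1..k} \<Longrightarrow>
      real_of_int (pair_count c {(p, q). p \<in> {..<N} \<and> q \<in> {..<N} \<and> p \<noteq> q} id i) = real N * real (N - 1) / real k"
  shows "\<exists>\<sigma>. \<sigma> permutes {..<N} \<and>
    (\<Sum>i=1..k. \<bar>real_of_int (pair_count c (block_graph r N) \<sigma> i) - real (r - 1) * real N / real k\<bar>)
      \<le> real (discr_bound k r)"
proof -
  let ?V = "{..<N}" and ?G = "block_graph r N"
  let ?f = "\<lambda>\<sigma>. \<Sum>i=1..k. \<bar>real_of_int (pair_count c ?G \<sigma> i) - real (r - 1) * real N / real k\<bar>"
  have N: "N \<ge> 2" using assms(1-3) by (cases m) auto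
  have "finite {\<sigma>. \<sigma> permutes ?V}" "{\<sigma>. \<sigma> permutes ?V} \<noteq> {}"
    using permutes_id[of ?V] by (auto simp: finite_permutations simp del: permutes_id)
  then obtain \<sigma> where \<sigma>: "\<sigma> permutes ?V" "\<And>\<rho>. \<rho> permutes ?V \<Longrightarrow> ?f \<sigma> \<le> ?f \<rho>"
    by (rule finite_minimiser[of _ ?f]) auto
  have "?f \<sigma> \<le> real (discr_bound (card {1..k}) r)"
  proof (rule local_minimum_bound[where J = "?V \<times> ?V" and \<tau> = "\<lambda>(p, q). transpose p q"
        and supp = "\<lambda>(p, q). {p div r, q div r}" and blk = "\<lambda>p. p div r"
        and \<beta> = "4 * real (N - 1)" and M = "{\<rho>. \<rho> permutes ?V}"])
    fix i assume i: "i \<in> {1..k}"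
    have "(\<Sum>(p, q)\<in>?V \<times> ?V. pair_count c ?G (\<sigma> \<circ> transpose p q) i - pair_count c ?G \<sigma> i) =
      4 * (int (r - 1) * pair_count c {(p, q). p \<in> ?V \<and> q \<in> ?V \<and> p \<noteq> q} id i
       - (int (card ?V) - 1) * pair_count c ?G \<sigma> i)"
      using \<sigma>(1) block_graph_degree[OF _ assms(2)] assms(1)
      by (intro transposition_drift) (auto simp: block_graph_def)
    then have "real_of_int (\<Sum>(p, q)\<in>?V \<times> ?V. pair_count c ?G (\<sigma> \<circ> transpose p q) i - pair_count c ?G \<sigma> i) =
      4 * (real (r - 1) * (real N * real (N - 1) / real k) - real (N - 1) * real_of_int (pair_count c ?G \<sigma> i))"
      using bal[OF i] N by (simp only:) (simp add: of_nat_diff)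
    also have "\<dots> = - (4 * real (N - 1)) * (real_of_int (pair_count c ?G \<sigma> i) - real (r - 1) * real N / real k)"
      by (simp add: algebra_simps)
    finally show "real_of_int (\<Sum>j\<in>?V \<times> ?V.
        pair_count c ?G (\<sigma> \<circ> (case j of (p, q) \<Rightarrow> transpose p q)) i - pair_count c ?G \<sigma> i) =
        - (4 * real (N - 1)) * (real_of_int (pair_count c ?G \<sigma> i) - real (r - 1) * real N / real k)"
      by (simp only: case_prod_unfold)
  next
    fix a
    let ?B = "{a * r..<a * r + r}"
    have "card {j\<in>?V \<times> ?V. a \<in> (case j of (p, q) \<Rightarrow> {p div r, q div r})} \<le> card (?B \<times> ?V \<union> ?V \<times> ?B)"
    proof (rule card_mono)
      have "p \<in> ?B" if "p div r = a" for p using that div_eq_iff_block assms(1) by simp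
      then show "{j\<in>?V \<times> ?V. a \<in> (case j of (p, q) \<Rightarrow> {p div r, q div r})} \<subseteq> ?B \<times> ?V \<union> ?V \<times> ?B"
        by blast
    qed simp
    also have "\<dots> \<le> card (?B \<times> ?V) + card (?V \<times> ?B)" by (rule card_Un_le)
    also have "\<dots> = 2 * N * r" by (simp add: card_cartesian_product)
    \<comment> \<open>\<open>N \<le> 2 * (N - 1)\<close> because \<open>N \<ge> 2\<close>: the moves
      touching one block are compared with the drift rate.\<close>
    also have "\<dots> \<le> (4 * (N - 1)) * r" using N by (intro mult_right_mono) auto
    finally have "real (card {j\<in>?V \<times> ?V. a \<in> (case j of (p, q) \<Rightarrow> {p div r, q div r})}) \<le> real ((4 * (N - 1)) * r)"
      by (simp only: of_nat_le_iff)
    then show "real (card {j\<in>?V \<times> ?V. a \<in> (case j of (p, q) \<Rightarrow> {p div r, q div r})}) \<le> 4 * real (N - 1) * real r"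
      by simp
  next
    fix \<rho> assume "\<rho> \<in> {\<rho>. \<rho> permutes ?V}"
    then have "\<sigma> \<circ> \<rho> permutes ?V" using \<sigma>(1) by (simp add: permutes_compose)
    then show "?f \<sigma> \<le> ?f (\<sigma> \<circ> \<rho>)" by (rule \<sigma>(2))
  next
    fix j \<rho> assume "j \<in> ?V \<times> ?V" "\<rho> \<in> {\<rho>. \<rho> permutes ?V}"
    then show "\<rho> \<circ> (case j of (p, q) \<Rightarrow> transpose p q) \<in> {\<rho>. \<rho> permutes ?V}"
      by (auto intro!: permutes_compose permutes_swap_id)
  next
    fix j :: "nat \<times> nat" and p
    show "p div r \<notin> (case j of (p, q) \<Rightarrow> {p div r, q div r}) \<Longrightarrow> (case j of (p, q) \<Rightarrow> transpose p q) p = p"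
      by (cases j) (auto simp: transpose_def)
    show "p div r \<in> (case j of (p, q) \<Rightarrow> {p div r, q div r}) \<Longrightarrow>
        (case j of (p, q) \<Rightarrow> transpose p q) p div r \<in> (case j of (p, q) \<Rightarrow> {p div r, q div r})"
      by (cases j) (auto simp: transpose_def)
    show "finite (case j of (p, q) \<Rightarrow> {p div r, q div r}) \<and> (case j of (p, q) \<Rightarrow> {p div r, q div r}) \<noteq> {} \<and>
        card (case j of (p, q) \<Rightarrow> {p div r, q div r}) \<le> 2"
      by (cases j) (auto simp: card_insert_if)
  qed (use assms(1) N finite_block_graph block_graph_size permutes_id in \<open>auto simp: block_graph_def\<close>)
  then show ?thesis using \<sigma>(1) by auto
qed

section \<open>Placing the copies inside the blocks\<close>

text \<open>The symmetric group on \<open>B\<close> is 2-transitive, so the sum over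
  \<open>\<tau>\<close> is the same for all ordered pairs of distinct points. Adding it over all
  these pairs counts the full pair sum once for each permutation.\<close>

lemma permutation_average:
  fixes f :: "'a \<Rightarrow> 'a \<Rightarrow> int"
  assumes "finite B" "p \<in> B" "q \<in> B" "p \<noteq> q"
  shows "int (card B * (card B - 1)) * (\<Sum>\<tau> | \<tau> permutes B. f (\<tau> p) (\<tau> q)) =
    fact (card B) * (\<Sum>(u, v)\<in>{(u, v). u \<in> B \<and> v \<in> B \<and> u \<noteq> v}. f u v)"
proof -
  let ?O = "{(u, v). u \<in> B \<and> v \<in> B \<and> u \<noteq> v}"
  define A where "A u v = (\<Sum>\<tau> | \<tau> permutes B. f (\<tau> u) (\<tau> v))" for u v
  have O: "?O = (SIGMA u:B. B - {u})" by auto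
  have cardO: "card ?O = card B * (card B - 1)"
    unfolding O using assms(1) by (subst card_SigmaI) auto
  have finO: "finite ?O" unfolding O using assms(1) by blast
  have const: "A u v = A p q" if "u \<in> B" "v \<in> B" "u \<noteq> v" for u v
  proof -
    \<comment> \<open>The inner transposition takes \<open>p\<close> to \<open>u\<close>; the outer
      one takes the image of \<open>q\<close> to \<open>v\<close> and fixes \<open>u\<close>, since
      neither of its two points is \<open>u\<close>.\<close>
    define g where "g = transpose (transpose p u q) v \<circ> transpose p u"
    have "transpose p u q \<in> B" using assms that by (auto simp: transpose_def)
    then have perm: "g permutes B"
      unfolding g_def using assms that by (intro permutes_compose permutes_swap_id)
    have "transpose p u q \<noteq> u" using assms(4) by (auto simp: transpose_def)
    then have "g p = u" "g q = v" using that(3) by (auto simp: g_def transpose_def)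
    then have "A u v = (\<Sum>\<tau> | \<tau> permutes B. f ((\<tau> \<circ> g) p) ((\<tau> \<circ> g) q))" by (simp add: A_def)
    also have "\<dots> = A p q"
      unfolding A_def
      by (rule sum_permutations_compose_right[OF perm, of "\<lambda>\<tau>. f (\<tau> p) (\<tau> q)", symmetric])
    finally show ?thesis .
  qed
  have "int (card B * (card B - 1)) * A p q = (\<Sum>(u, v)\<in>?O. A p q)" using cardO by simp
  also have "\<dots> = (\<Sum>(u, v)\<in>?O. A u v)"
    using const by (intro sum.cong refl) (auto split: prod.splits)
  also have "\<dots> = (\<Sum>\<tau> | \<tau> permutes B. \<Sum>(u, v)\<in>?O. f (\<tau> u) (\<tau> v))"
    unfolding A_def case_prod_unfold by (rule sum.swap)
  also have "\<dots> = (\<Sum>\<tau> | \<tau> permutes B. \<Sum>(u, v)\<in>?O. f u v)"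
  proof (rule sum.cong[OF refl])
    fix \<tau> assume "\<tau> \<in> {\<tau>. \<tau> permutes B}"
    then have \<tau>: "\<tau> permutes B" by simp
    have "inj_on (map_prod \<tau> \<tau>) ?O" using permutes_inj[OF \<tau>] by (auto simp: inj_on_def)
    moreover have "map_prod \<tau> \<tau> ` ?O \<subseteq> ?O"
      using \<tau> permutes_inj[OF \<tau>] by (auto simp: permutes_in_image inj_eq)
    ultimately have "bij_betw (map_prod \<tau> \<tau>) ?O ?O"
      using finO by (simp add: bij_betw_def endo_inj_surj)
    from sum.reindex_bij_betw[OF this, of "\<lambda>(u, v). f u v"]
    show "(\<Sum>(u, v)\<in>?O. f (\<tau> u) (\<tau> v)) = (\<Sum>(u, v)\<in>?O. f u v)"
      by (simp add: case_prod_unfold)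
  qed
  also have "\<dots> = fact (card B) * (\<Sum>(u, v)\<in>?O. f u v)"
    using card_permutations[OF refl assms(1)] by simp
  finally show ?thesis by (simp add: A_def)
qed

text \<open>A uniformly random permutation of one block gives its \<open>e\<close> ordered pairs, in
  expectation, the colour proportions of the clique on that block. Summed over all permutations of
  all blocks, the drift is \<open>- fact r\<close> times the deviation from the target, whether or
  not the copies are regular. The clique counts are invariant under \<open>M\<close>, so the target
  stays fixed during the minimisation.\<close>

lemma factor_inside_blocks:
  assumes r: "r \<ge> 2" and N: "N = m * r" and \<sigma>: "\<sigma> permutes {..<N}"
    and G: "G \<subseteq> block_graph r N"
    and uniform: "\<And>a. a < m \<Longrightarrow> card {(p, q)\<in>G. p div r = a} = e"
  shows "\<exists>\<sigma>'. \<sigma>' permutes {..<N} \<and>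
    (\<Sum>i=1..k. \<bar>real_of_int (pair_count c G \<sigma>' i) -
        real e / real (r * (r - 1)) * real_of_int (pair_count c (block_graph r N) \<sigma> i)\<bar>)
      \<le> real (discr_bound k r)"
proof -
  let ?V = "{..<N}" and ?K = "block_graph r N"
  let ?B = "\<lambda>a. {a * r..<a * r + r}"
  let ?J = "SIGMA a:{..<m}. {\<tau>. \<tau> permutes ?B a}"
  define \<mu> where "\<mu> i = real e / real (r * (r - 1)) * real_of_int (pair_count c ?K \<sigma> i)" for i
  define M where "M = {\<rho>. \<rho> permutes ?V \<and> (\<forall>p. \<rho> p div r = p div r)}"
  let ?f = "\<lambda>\<sigma>. \<Sum>i=1..k. \<bar>real_of_int (pair_count c G \<sigma> i) - \<mu> i\<bar>"
  have r0: "r > 0" using r by simp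
  have blk: "p div r = a \<longleftrightarrow> p \<in> ?B a" for p a by (rule div_eq_iff_block[OF r0])
  have finG: "finite G" using G finite_block_graph finite_subset by blast
  have B_sub: "?B a \<subseteq> ?V" if "a < m" for a
  proof -
    have "Suc a * r \<le> N" using that N by (metis Suc_leI mult_le_mono1)
    then show ?thesis by auto
  qed
  have inM: "\<tau> \<in> M" if "\<tau> permutes ?B a" "a < m" for \<tau> a
  proof -
    have "\<tau> p div r = p div r" for p
    proof (cases "p \<in> ?B a")
      case True
      then have "\<tau> p \<in> ?B a" using permutes_in_image[OF that(1)] by metis
      then show ?thesis using True blk by metis
    next
      case False
      then show ?thesis using permutes_not_in[OF that(1)] by metis
    qed
    then show ?thesis using permutes_subset[OF that(1) B_sub[OF that(2)]] by (simp add: M_def)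
  qed
  have M_comp: "\<rho> \<circ> \<rho>' \<in> M" if "\<rho> \<in> M" "\<rho>' \<in> M" for \<rho> \<rho>'
    using that by (simp add: M_def permutes_compose)
  have id_M: "id \<in> M" by (simp add: M_def permutes_id)
  have K_inv: "pair_count c ?K (\<sigma> \<circ> \<rho>) i = pair_count c ?K \<sigma> i" if "\<rho> \<in> M" for \<rho> \<sigma> i
  proof (rule pair_count_reindex, rule bij_betw_map_prod)
    show "\<rho> permutes ?V" using that by (simp add: M_def)
    fix p q assume "(p, q) \<in> ?K"
    then show "(\<rho> p, \<rho> q) \<in> ?K"
      using that permutes_in_image[of \<rho> ?V] permutes_inj[of \<rho> ?V]
      by (auto simp: M_def block_graph_def inj_eq)
  qed (rule finite_block_graph)
  have "finite M"
    by (rule finite_subset[of _ "{\<rho>. \<rho> permutes ?V}"]) (auto simp: M_def finite_permutations)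
  then obtain \<rho> where \<rho>: "\<rho> \<in> M" "\<And>\<rho>'. \<rho>' \<in> M \<Longrightarrow> ?f (\<sigma> \<circ> \<rho>) \<le> ?f (\<sigma> \<circ> \<rho>')"
    using finite_minimiser[of M "\<lambda>\<rho>. ?f (\<sigma> \<circ> \<rho>)"] id_M by blast
  define \<sigma>' where "\<sigma>' = \<sigma> \<circ> \<rho>"
  have \<sigma>': "\<sigma>' permutes ?V"
    using \<rho>(1) \<sigma> by (simp add: \<sigma>'_def M_def permutes_compose)
  have block_drift: "real_of_int (\<Sum>\<tau> | \<tau> permutes ?B a. pair_count c G (\<sigma>' \<circ> \<tau>) i - pair_count c G \<sigma>' i) =
      fact r * (real e / real (r * (r - 1)) * real_of_int (pair_count c {(p, q)\<in>?K. p div r = a} \<sigma>' i)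
        - real_of_int (pair_count c {(p, q)\<in>G. p div r = a} \<sigma>' i))" if a: "a < m" for a i
  proof -
    define Ga where "Ga = {(p, q)\<in>G. p div r = a}"
    define Ka where "Ka = {(p, q)\<in>?K. p div r = a}"
    define w where "w u v = (of_bool (c {\<sigma>' u, \<sigma>' v} = i) :: int)" for u v
    have K_eq: "Ka = {(u, v). u \<in> ?B a \<and> v \<in> ?B a \<and> u \<noteq> v}"
      using B_sub[OF a] unfolding Ka_def block_graph_def
      by (auto simp: blk[symmetric] subset_iff simp del: atLeastLessThan_iff)
    have Ga: "Ga \<subseteq> G" "card Ga = e" "Ga \<subseteq> Ka"
      using uniform[OF a] G by (auto simp: Ga_def Ka_def)
    have cardP: "card {\<tau>. \<tau> permutes ?B a} = fact r"
      by (rule card_permutations) auto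
    have diff: "pair_count c G (\<sigma>' \<circ> \<tau>) i - pair_count c G \<sigma>' i =
        (\<Sum>(p, q)\<in>Ga. w (\<tau> p) (\<tau> q)) - pair_count c Ga \<sigma>' i" if \<tau>: "\<tau> permutes ?B a" for \<tau>
    proof -
      have split: "pair_count c G s i = pair_count c (G - Ga) s i + pair_count c Ga s i" for s
        unfolding pair_count_def by (rule sum.subset_diff[OF Ga(1) finG])
      have "pair_count c (G - Ga) (\<sigma>' \<circ> \<tau>) i = pair_count c (G - Ga) \<sigma>' i"
        unfolding pair_count_def
      proof (intro sum.cong refl)
        fix x assume x: "x \<in> G - Ga"
        obtain p q where pq: "x = (p, q)" by (cases x)
        have "p div r = q div r" using x G pq by (auto simp: block_graph_def)
        moreover have "p div r \<noteq> a" using x pq by (auto simp: Ga_def)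
        ultimately have "p \<notin> ?B a" "q \<notin> ?B a" using blk by metis+
        then have "\<tau> p = p" "\<tau> q = q" using permutes_not_in[OF \<tau>] by metis+
        then show "(case x of (p, q) \<Rightarrow> of_bool (c {(\<sigma>' \<circ> \<tau>) p, (\<sigma>' \<circ> \<tau>) q} = i)) =
            (case x of (p, q) \<Rightarrow> (of_bool (c {\<sigma>' p, \<sigma>' q} = i) :: int))"
          by (simp add: pq)
      qed
      moreover have "pair_count c Ga (\<sigma>' \<circ> \<tau>) i = (\<Sum>(p, q)\<in>Ga. w (\<tau> p) (\<tau> q))"
        by (simp add: pair_count_def w_def)
      ultimately show ?thesis using split by simp
    qed
    have pcK: "pair_count c Ka \<sigma>' i = (\<Sum>(u, v)\<in>{(u, v). u \<in> ?B a \<and> v \<in> ?B a \<and> u \<noteq> v}. w u v)"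
      unfolding K_eq by (simp add: pair_count_def w_def)
    have avg: "int (r * (r - 1)) * (\<Sum>\<tau> | \<tau> permutes ?B a. w (\<tau> p) (\<tau> q)) = fact r * pair_count c Ka \<sigma>' i"
      if "(p, q) \<in> Ga" for p q
    proof -
      have "p \<in> ?B a" "q \<in> ?B a" "p \<noteq> q" using that Ga(3) K_eq by auto
      from permutation_average[OF _ this, of w] show ?thesis unfolding pcK by simp
    qed
    have "(\<Sum>\<tau> | \<tau> permutes ?B a. \<Sum>(p, q)\<in>Ga. w (\<tau> p) (\<tau> q)) =
        (\<Sum>(p, q)\<in>Ga. \<Sum>\<tau> | \<tau> permutes ?B a. w (\<tau> p) (\<tau> q))"
      unfolding case_prod_unfold by (rule sum.swap)
    then have "int (r * (r - 1)) * (\<Sum>\<tau> | \<tau> permutes ?B a. \<Sum>(p, q)\<in>Ga. w (\<tau> p) (\<tau> q)) =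
        (\<Sum>(p, q)\<in>Ga. int (r * (r - 1)) * (\<Sum>\<tau> | \<tau> permutes ?B a. w (\<tau> p) (\<tau> q)))"
      by (simp only: sum_distrib_left case_prod_unfold)
    also have "\<dots> = (\<Sum>(p, q)\<in>Ga. fact r * pair_count c Ka \<sigma>' i)"
      by (intro sum.cong refl) (use avg in \<open>auto split: prod.splits\<close>)
    also have "\<dots> = int e * (fact r * pair_count c Ka \<sigma>' i)" using Ga(2) by simp
    finally have "real_of_int (int (r * (r - 1)) * (\<Sum>\<tau> | \<tau> permutes ?B a. \<Sum>(p, q)\<in>Ga. w (\<tau> p) (\<tau> q))) =
        real_of_int (int e * (fact r * pair_count c Ka \<sigma>' i))" by (simp only:)
    then have prod: "real (r * (r - 1)) * real_of_int (\<Sum>\<tau> | \<tau> permutes ?B a. \<Sum>(p, q)\<in>Ga. w (\<tau> p) (\<tau> q)) =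
        real e * (fact r * real_of_int (pair_count c Ka \<sigma>' i))"
      by (simp only: of_int_mult of_int_of_nat_eq of_int_fact)
    have "real (r * (r - 1)) \<noteq> 0" using r by simp
    then have avg': "real_of_int (\<Sum>\<tau> | \<tau> permutes ?B a. \<Sum>(p, q)\<in>Ga. w (\<tau> p) (\<tau> q)) =
        fact r * (real e / real (r * (r - 1)) * real_of_int (pair_count c Ka \<sigma>' i))"
      using prod by (simp add: field_simps)
    have "(\<Sum>\<tau> | \<tau> permutes ?B a. pair_count c G (\<sigma>' \<circ> \<tau>) i - pair_count c G \<sigma>' i) =
        (\<Sum>\<tau> | \<tau> permutes ?B a. (\<Sum>(p, q)\<in>Ga. w (\<tau> p) (\<tau> q)) - pair_count c Ga \<sigma>' i)"
      using diff by (intro sum.cong refl) simp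
    also have "\<dots> = (\<Sum>\<tau> | \<tau> permutes ?B a. \<Sum>(p, q)\<in>Ga. w (\<tau> p) (\<tau> q)) - fact r * pair_count c Ga \<sigma>' i"
      using cardP by (simp add: sum_subtractf)
    finally show ?thesis
      unfolding Ga_def[symmetric] Ka_def[symmetric]
      by (simp only: of_int_diff of_int_mult of_int_fact avg' right_diff_distrib)
  qed
  have blocks: "(\<Sum>a<m. pair_count c {(p, q)\<in>E. p div r = a} s i) = pair_count c E s i"
    if "E \<subseteq> ?K" for E s i
  proof -
    have finE: "finite E" using that finite_block_graph finite_subset by blast
    have "(\<Sum>a<m. pair_count c {(p, q)\<in>E. p div r = a} s i) =
        (\<Sum>a<m. \<Sum>x\<in>{x\<in>E. fst x div r = a}. of_bool (c {s (fst x), s (snd x)} = i))"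
      by (simp add: pair_count_def case_prod_unfold)
    also have "\<dots> = (\<Sum>x\<in>E. of_bool (c {s (fst x), s (snd x)} = i))"
    proof (rule sum.group[OF finE])
      show "(\<lambda>x. fst x div r) ` E \<subseteq> {..<m}"
        using that N by (auto simp: block_graph_def less_mult_imp_div_less)
    qed simp
    finally show ?thesis by (simp add: pair_count_def case_prod_unfold)
  qed
  have "?f \<sigma>' \<le> real (discr_bound (card {1..k}) r)"
  proof (rule local_minimum_bound[where J = ?J and \<tau> = snd and supp = "\<lambda>j. {fst j}"
        and blk = "\<lambda>p. p div r" and \<beta> = "fact r" and M = M])
    fix i assume "i \<in> {1..k}"
    have "real_of_int (\<Sum>j\<in>?J. pair_count c G (\<sigma>' \<circ> snd j) i - pair_count c G \<sigma>' i) =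
        (\<Sum>a<m. real_of_int (\<Sum>\<tau> | \<tau> permutes ?B a. pair_count c G (\<sigma>' \<circ> \<tau>) i - pair_count c G \<sigma>' i))"
      unfolding of_int_sum by (subst sum.Sigma) (auto simp: finite_permutations case_prod_unfold)
    also have "\<dots> = (\<Sum>a<m. fact r * (real e / real (r * (r - 1)) *
        real_of_int (pair_count c {(p, q)\<in>?K. p div r = a} \<sigma>' i)
        - real_of_int (pair_count c {(p, q)\<in>G. p div r = a} \<sigma>' i)))"
      by (intro sum.cong refl block_drift) simp
    also have "\<dots> = fact r * (real e / real (r * (r - 1)) * real_of_int (pair_count c ?K \<sigma>' i)
        - real_of_int (pair_count c G \<sigma>' i))"
      unfolding blocks[OF G, symmetric] blocks[OF subset_refl, symmetric]
      by (simp only: sum_distrib_left sum_subtractf[symmetric] of_int_sum)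
    also have "pair_count c ?K \<sigma>' i = pair_count c ?K \<sigma> i"
      unfolding \<sigma>'_def by (rule K_inv[OF \<rho>(1)])
    also have "fact r * (real e / real (r * (r - 1)) * real_of_int (pair_count c ?K \<sigma> i)
        - real_of_int (pair_count c G \<sigma>' i)) = - fact r * (real_of_int (pair_count c G \<sigma>' i) - \<mu> i)"
      by (simp add: \<mu>_def algebra_simps)
    finally show "real_of_int (\<Sum>j\<in>?J. pair_count c G (\<sigma>' \<circ> snd j) i - pair_count c G \<sigma>' i) =
        - fact r * (real_of_int (pair_count c G \<sigma>' i) - \<mu> i)" .
  next
    fix a
    have "card {j\<in>?J. a \<in> {fst j}} \<le> card ({a} \<times> {\<tau>. \<tau> permutes ?B a})"
      by (intro card_mono) (auto simp: finite_permutations)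
    also have "\<dots> = fact r" using card_permutations[of "?B a" r] by (simp add: card_cartesian_product)
    also have "\<dots> \<le> fact r * r" using r by simp
    finally have "real (card {j\<in>?J. a \<in> {fst j}}) \<le> real (fact r * r)" by (simp only: of_nat_le_iff)
    then show "real (card {j\<in>?J. a \<in> {fst j}}) \<le> fact r * real r" by simp
  next
    fix \<rho>' assume "\<rho>' \<in> M"
    then show "?f \<sigma>' \<le> ?f (\<sigma>' \<circ> \<rho>')"
      using \<rho>(2)[OF M_comp[OF \<rho>(1)]] by (simp add: \<sigma>'_def comp_assoc)
  next
    fix j \<rho>' assume "j \<in> ?J" "\<rho>' \<in> M"
    then show "\<rho>' \<circ> snd j \<in> M" using M_comp inM by auto
  next
    fix j p assume j: "j \<in> ?J"
    show "p div r \<notin> {fst j} \<Longrightarrow> snd j p = p"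
      using j blk[of p "fst j"] permutes_not_in[of "snd j" "?B (fst j)" p] by auto
    have "snd j \<in> M" using j inM by auto
    then show "p div r \<in> {fst j} \<Longrightarrow> snd j p div r \<in> {fst j}" by (simp add: M_def)
  next
    fix a
    have "card {(p, q)\<in>G. p div r = a} \<le> card {(p, q)\<in>?K. p div r = a}"
      using G finite_block_graph by (intro card_mono) (auto intro: finite_subset[of _ ?K])
    then show "card {(p, q)\<in>G. p div r = a} \<le> r\<^sup>2" using block_graph_size[OF r0] le_trans by blast
  next
    fix p q assume "(p, q) \<in> G"
    then show "q div r = p div r" using G by (auto simp: block_graph_def)
  qed (use finG r id_M in \<open>auto simp: finite_permutations\<close>)
  then show ?thesis using \<sigma>' by (auto simp: \<mu>_def)
qed

section \<open>From pairs of positions to factors\<close>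

lemma card_ordered_pairs:
  assumes "finite G" "inj \<sigma>" and sym: "\<And>p q. (p, q) \<in> G \<Longrightarrow> (q, p) \<in> G"
    and irrefl: "\<And>p q. (p, q) \<in> G \<Longrightarrow> p \<noteq> q"
  shows "card G = 2 * card ((\<lambda>(p, q). {\<sigma> p, \<sigma> q}) ` G)"
proof -
  let ?g = "\<lambda>(p, q). {\<sigma> p, \<sigma> q}"
  have "card {x\<in>G. ?g x = e} = 2" if e: "e \<in> ?g ` G" for e
  proof -
    obtain x where "x \<in> G" "e = ?g x" using e by blast
    then obtain p q where pq: "(p, q) \<in> G" "e = {\<sigma> p, \<sigma> q}" by (cases x) auto
    have "{x\<in>G. ?g x = e} = {(p, q), (q, p)}"
      using pq sym injD[OF assms(2)] by (auto simp: doubleton_eq_iff)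
    then show ?thesis using irrefl[OF pq(1)] by simp
  qed
  then have "(\<Sum>e\<in>?g ` G. \<Sum>x\<in>{x\<in>G. ?g x = e}. 1) = (\<Sum>e\<in>?g ` G. 2::nat)"
    by (intro sum.cong refl) simp
  then show ?thesis using sum.image_gen[OF assms(1), of "\<lambda>_. 1::nat" ?g] by simp
qed

lemma pair_count_eq_card:
  assumes "finite G" "inj \<sigma>" "\<And>p q. (p, q) \<in> G \<Longrightarrow> (q, p) \<in> G" "\<And>p q. (p, q) \<in> G \<Longrightarrow> p \<noteq> q"
  shows "pair_count c G \<sigma> i = 2 * int (card {e \<in> (\<lambda>(p, q). {\<sigma> p, \<sigma> q}) ` G. c e = i})"
proof -
  let ?Gi = "{(p, q)\<in>G. c {\<sigma> p, \<sigma> q} = i}"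
  have "pair_count c G \<sigma> i = int (card ?Gi)"
    unfolding pair_count_def case_prod_unfold using assms(1) by (simp add: Int_def)
  also have "card ?Gi = 2 * card ((\<lambda>(p, q). {\<sigma> p, \<sigma> q}) ` ?Gi)"
    using assms by (intro card_ordered_pairs) (auto intro: finite_subset[of _ G] simp: insert_commute)
  also have "(\<lambda>(p, q). {\<sigma> p, \<sigma> q}) ` ?Gi = {e \<in> (\<lambda>(p, q). {\<sigma> p, \<sigma> q}) ` G. c e = i}" by auto
  finally show ?thesis by simp
qed

lemma edges_complete_graph:
  "edges (complete_graph N) = (\<lambda>(p, q). {id p, id q}) ` {(p, q). p \<in> {..<N} \<and> q \<in> {..<N} \<and> p \<noteq> q}"
proof (intro set_eqI iffI)
  fix e assume "e \<in> edges (complete_graph N)"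
  then have "e \<subseteq> {..<N}" "card e = 2" by (auto simp: complete_graph_def nsets_def)
  then show "e \<in> (\<lambda>(p, q). {id p, id q}) ` {(p, q). p \<in> {..<N} \<and> q \<in> {..<N} \<and> p \<noteq> q}"
    by (auto simp: card_2_iff)
qed (auto simp: complete_graph_def nsets_def)

lemma balanced_pair_count:
  assumes "balanced_colouring (complete_graph N) k c" "i \<in> {1..k}"
  shows "real_of_int (pair_count c {(p, q). p \<in> {..<N} \<and> q \<in> {..<N} \<and> p \<noteq> q} id i) =
    real N * real (N - 1) / real k"
proof -
  let ?O = "{(p, q). p \<in> {..<N} \<and> q \<in> {..<N} \<and> p \<noteq> q}"
  let ?E = "edges (complete_graph N)" and ?C = "colour_class (complete_graph N) c"
  have O: "?O = (SIGMA p:{..<N}. {..<N} - {p})" by auto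
  have cardO: "card ?O = N * (N - 1)" unfolding O by (subst card_SigmaI) auto
  have finO: "finite ?O" unfolding O by blast
  have finE: "finite ?E" unfolding edges_complete_graph using finO by blast
  have "c ` ?E \<subseteq> {1..k}"
    using assms(1) unfolding balanced_colouring_def edge_colouring_def by blast
  from sum.group[OF finE finite_atLeastAtMost this, of "\<lambda>_. 1::nat"]
  have "card ?E = (\<Sum>j=1..k. card (?C j))" by (simp add: colour_class_def)
  also have "\<dots> = (\<Sum>j=1..k. card (?C i))"
    by (intro sum.cong refl) (use assms in \<open>unfold balanced_colouring_def, blast\<close>)
  finally have E: "card ?E = k * card (?C i)" by simp
  have "card ?O = 2 * card ((\<lambda>(p, q). {id p, id q}) ` ?O)"
    by (rule card_ordered_pairs[OF finO]) auto
  then have "N * (N - 1) = 2 * card ?E" by (simp only: cardO edges_complete_graph)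
  then have "real N * real (N - 1) = real (2 * (k * card (?C i)))"
    unfolding E by (simp only: of_nat_mult[symmetric])
  moreover have "pair_count c ?O id i = 2 * int (card (?C i))"
    unfolding colour_class_def edges_complete_graph using finO by (intro pair_count_eq_card) auto
  ultimately have "real N * real (N - 1) = real k * real_of_int (pair_count c ?O id i)" by simp
  moreover have "k > 0" using assms(2) by auto
  ultimately show ?thesis by (simp add: field_simps)
qed

text \<open>With \<open>X = 8 * k * r\<close>, the bases \<open>4 * r\<^sup>2\<close> and
  \<open>4 * r\<^sup>2 + 1\<close> are at most \<open>X\<^sup>2\<close>, and the remaining
  polynomial factors fit into \<open>X ^ 3\<close>. What is left is a power of \<open>X\<close> with
  exponent of order \<open>2 ^ k\<close>, for which \<open>X ^ k\<close> leaves ample room.\<close>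

lemma discr_bound_le:
  assumes "k \<ge> 2" "r \<ge> 2"
  shows "discr_bound k r \<le> (8 * k * r) ^ ((8 * k * r) ^ k)"
proof -
  define X D T where "X = 8 * k * r" and "D = (2 * (2 * r\<^sup>2)) ^ (2 ^ k - 1)"
    and "T = (2 * (2 * r\<^sup>2) + 1) ^ k"
  have "2 * 2 \<le> k * r" using assms by (intro mult_le_mono)
  then have X: "X \<ge> 32" by (simp add: X_def)
  have k1: "k \<ge> 1" and r1: "r \<ge> 1" using assms by auto
  have "8 * 1 * r \<le> X" unfolding X_def using k1 by (intro mult_le_mono) auto
  then have X2: "64 * r\<^sup>2 \<le> X\<^sup>2" using power_mono[of "8 * r" X 2] by (simp add: power_mult_distrib)
  have "r\<^sup>2 \<ge> 1" using r1 by simp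
  then have b1: "2 * (2 * r\<^sup>2) \<le> X\<^sup>2" "2 * (2 * r\<^sup>2) + 1 \<le> X\<^sup>2" using X2 by linarith+
  have D: "D \<le> X ^ (2 * (2 ^ k - 1))" unfolding D_def power_mult by (rule power_mono[OF b1(1)]) simp
  have T: "T \<le> X ^ (2 * k)" unfolding T_def power_mult by (rule power_mono[OF b1(2)]) simp
  have T1: "T \<ge> 1" unfolding T_def by simp
  have "2 * k + 4 * (r ^ 3 * k) \<le> X ^ 3"
  proof -
    have "k ^ 1 \<le> k ^ 3" by (rule power_increasing) (use k1 in auto)
    then have "r ^ 3 * k \<le> r ^ 3 * k ^ 3" by simp
    moreover have "1 * k \<le> r ^ 3 * k" using r1 by (intro mult_le_mono1) simp
    moreover have "X ^ 3 = 512 * (r ^ 3 * k ^ 3)" by (simp add: X_def power_mult_distrib)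
    ultimately show ?thesis by linarith
  qed
  have "discr_bound k r = 2 * D * k + T * (2 * D) * r * (2 * r\<^sup>2) * k"
    unfolding discr_bound_def Let_def D_def T_def by (rule refl)
  also have "\<dots> = D * (2 * k + T * (4 * (r ^ 3 * k)))"
    by (simp add: algebra_simps power2_eq_square power3_eq_cube)
  also have "\<dots> \<le> D * (T * (2 * k) + T * (4 * (r ^ 3 * k)))"
    using T1 by (intro mult_le_mono2 add_le_mono1) simp
  also have "\<dots> = D * (T * (2 * k + 4 * (r ^ 3 * k)))" by (simp add: algebra_simps)
  also have "\<dots> \<le> X ^ (2 * (2 ^ k - 1)) * (X ^ (2 * k) * X ^ 3)"
    using D T \<open>2 * k + 4 * (r ^ 3 * k) \<le> X ^ 3\<close> by (intro mult_le_mono)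
  also have "\<dots> = X ^ (2 * (2 ^ k - 1) + 2 * k + 3)" by (simp add: power_add)
  also have "\<dots> \<le> X ^ (X ^ k)"
  proof (rule power_increasing)
    have "k < 2 ^ k" by (rule less_exp)
    then have "2 * (2 ^ k - 1) + 2 * k + 3 \<le> 16 * (2::nat) ^ k" by linarith
    also have "\<dots> \<le> 16 ^ k * 2 ^ k"
      using self_le_power[of "16::nat" k] k1 by (intro mult_le_mono1) simp
    also have "\<dots> = 32 ^ k" by (simp flip: power_mult_distrib)
    also have "\<dots> \<le> X ^ k" using X by (intro power_mono) auto
    finally show "2 * (2 ^ k - 1) + 2 * k + 3 \<le> X ^ k" .
  qed (use X in auto)
  finally show ?thesis by (simp add: X_def)
qed

text \<open>The placement stage follows the clique counts scaled by
  \<open>\<rho> = e / (r * (r - 1))\<close>, and \<open>\<rho> \<le> 1\<close> keeps the error of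
  the clique stage from growing. The two errors, each at most \<open>discr_bound k r\<close>, add
  up, but they are measured in ordered pairs; passing to edges halves the sum and restores a single
  \<open>discr_bound k r\<close>.\<close>

lemma factor_with_small_discrepancy:
  fixes H :: "'b graph"
  assumes H: "simple_graph H" "card (verts H) = r" and "k \<ge> 2" "r \<ge> 2" "n > 0"
    and bal: "balanced_colouring (complete_graph (n * r * k)) k c"
  shows "\<exists>F. H_factor H (complete_graph (n * r * k)) F \<and>
    discrepancy (complete_graph (n * r * k)) k c F \<le> real (discr_bound k r)"
proof -
  define m N where "m = n * k" and "N = n * r * k"
  have N: "N = m * r" by (simp add: m_def N_def)
  have m: "m > 0" using assms by (simp add: m_def)
  have r0: "r > 0" using assms by simp
  let ?K = "block_graph r N" and ?V = "{..<N}"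
  let ?B = "\<lambda>a. {a * r..<a * r + r}"
  have blk: "p div r = a \<longleftrightarrow> p \<in> ?B a" for p a by (rule div_eq_iff_block[OF r0])
  obtain h where h: "bij_betw h {0..<r} (verts H)"
    using ex_bij_betw_nat_finite[of "verts H"] H by (auto simp: simple_graph_def)
  \<comment> \<open>Position \<open>p\<close> plays the vertex \<open>h (p mod r)\<close>, so every
    block carries the same copy of \<open>H\<close> and the same number \<open>e\<close> of ordered
    pairs, twice the number of edges of \<open>H\<close>.\<close>
  define G where "G = {(p, q)\<in>?K. {h (p mod r), h (q mod r)} \<in> edges H}"
  define Q where "Q = {(x, y). x < r \<and> y < r \<and> x \<noteq> y \<and> {h x, h y} \<in> edges H}"
  define e where "e = card Q"
  have GK: "G \<subseteq> ?K" by (auto simp: G_def)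
  have finG: "finite G" using GK finite_block_graph finite_subset by blast
  have G_sym: "(q, p) \<in> G" if "(p, q) \<in> G" for p q
    using that by (auto simp: G_def block_graph_def insert_commute)
  have G_irrefl: "p \<noteq> q" if "(p, q) \<in> G" for p q using that by (auto simp: G_def block_graph_def)
  have B_sub: "?B a \<subseteq> ?V" if "a < m" for a
  proof -
    have "Suc a * r \<le> N" using that N by (metis Suc_leI mult_le_mono1)
    then show ?thesis by auto
  qed
  have uniform: "card {(p, q)\<in>G. p div r = a} = e" if a: "a < m" for a
  proof -
    have "bij_betw (\<lambda>(x, y). (a * r + x, a * r + y)) Q {(p, q)\<in>G. p div r = a}"
    proof (rule bij_betwI[where g = "\<lambda>(p, q). (p mod r, q mod r)"])
      show "(\<lambda>(x, y). (a * r + x, a * r + y)) \<in> Q \<rightarrow> {(p, q)\<in>G. p div r = a}"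
        using B_sub[OF a] by (auto simp: Q_def G_def block_graph_def subset_iff)
      show "(\<lambda>(p, q). (p mod r, q mod r)) \<in> {(p, q)\<in>G. p div r = a} \<rightarrow> Q"
      proof (clarsimp simp: G_def block_graph_def Q_def r0)
        fix p q assume "p \<noteq> q" "p div r = q div r" "p mod r = q mod r"
        then show False by (metis div_mult_mod_eq)
      qed
      fix x assume "x \<in> {(p, q)\<in>G. p div r = a}"
      then have "fst x div r = a" "snd x div r = a" using GK by (auto simp: block_graph_def)
      then show "(\<lambda>(x, y). (a * r + x, a * r + y)) ((\<lambda>(p, q). (p mod r, q mod r)) x) = x"
        using div_mult_mod_eq[of "fst x" r] div_mult_mod_eq[of "snd x" r] by (cases x) simp
    qed (auto simp: Q_def)
    then show ?thesis by (simp add: e_def bij_betw_same_card)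
  qed
  have card_G: "card G = m * e"
  proof -
    have "(\<lambda>x. fst x div r) ` G \<subseteq> {..<m}"
      using GK N by (auto simp: block_graph_def less_mult_imp_div_less)
    from sum.group[OF finG _ this, of "\<lambda>_. 1::nat"]
    have "card G = (\<Sum>a<m. card {x\<in>G. fst x div r = a})" by simp
    then show ?thesis using uniform by (simp add: case_prod_unfold)
  qed
  have "card Q \<le> card (SIGMA x:{..<r}. {..<r} - {x})"
    by (intro card_mono) (auto simp: Q_def)
  also have "\<dots> = r * (r - 1)" by (subst card_SigmaI) auto
  finally have e_le: "e \<le> r * (r - 1)" by (simp add: e_def)

  have "k > 0" using assms(3) by simp
  then have "\<exists>\<sigma>. \<sigma> permutes ?V \<and>
    (\<Sum>i=1..k. \<bar>real_of_int (pair_count c ?K \<sigma> i) - real (r - 1) * real N / real k\<bar>)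
      \<le> real (discr_bound k r)"
    using balanced_pair_count[OF bal[folded N_def]] by (rule balanced_clique_factor[OF assms(4) N m])
  then obtain \<sigma>0 where \<sigma>0: "\<sigma>0 permutes ?V"
    "(\<Sum>i=1..k. \<bar>real_of_int (pair_count c ?K \<sigma>0 i) - real (r - 1) * real N / real k\<bar>)
      \<le> real (discr_bound k r)"
    by (elim exE conjE)
  have "\<exists>\<sigma>. \<sigma> permutes ?V \<and>
    (\<Sum>i=1..k. \<bar>real_of_int (pair_count c G \<sigma> i) -
        real e / real (r * (r - 1)) * real_of_int (pair_count c ?K \<sigma>0 i)\<bar>) \<le> real (discr_bound k r)"
    using uniform by (rule factor_inside_blocks[OF assms(4) N \<sigma>0(1) GK])
  then obtain \<sigma> where \<sigma>: "\<sigma> permutes ?V"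
    "(\<Sum>i=1..k. \<bar>real_of_int (pair_count c G \<sigma> i) -
        real e / real (r * (r - 1)) * real_of_int (pair_count c ?K \<sigma>0 i)\<bar>) \<le> real (discr_bound k r)"
    by (elim exE conjE)
  have inj: "inj \<sigma>" using permutes_inj[OF \<sigma>(1)] .
  define \<phi> where "\<phi> = (\<lambda>(p, q). {\<sigma> p, \<sigma> q})"
  define A where "A a = (\<sigma> ` ?B a, \<phi> ` {(p, q)\<in>G. p div r = a})" for a
  define F where "F = (?V, \<phi> ` G)"
  have KN: "verts (complete_graph N) = ?V" "edges (complete_graph N) = [?V]\<^bsup>2\<^esup>"
    by (simp_all add: complete_graph_def)
  have G_block: "p \<in> ?B a \<and> q \<in> ?B a" if "(p, q) \<in> G" "p div r = a" for p q a
  proof -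
    have "q div r = a" using that GK by (auto simp: block_graph_def)
    then show ?thesis using that(2) blk by blast
  qed
  have edges_A: "edges (A a) \<subseteq> [verts (A a)]\<^bsup>2\<^esup>" for a
  proof
    fix x assume "x \<in> edges (A a)"
    then obtain p q where pq: "(p, q) \<in> G" "p div r = a" "x = {\<sigma> p, \<sigma> q}" by (auto simp: A_def \<phi>_def)
    then show "x \<in> [verts (A a)]\<^bsup>2\<^esup>"
      using G_block[OF pq(1,2)] G_irrefl[OF pq(1)]
      by (simp add: A_def nsets_def inj_eq[OF inj] del: atLeastLessThan_iff)
  qed
  have verts_A: "verts (A a) \<subseteq> ?V" if "a < m" for a
    using B_sub[OF that] permutes_in_image[OF \<sigma>(1)] by (fastforce simp: A_def)
  have sub: "subgraph (A a) (complete_graph N)" if "a < m" for a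
    unfolding subgraph_def simple_graph_def KN
  proof (intro conjI)
    show "finite (verts (A a))" by (simp add: A_def)
    show "edges (A a) \<subseteq> [verts (A a)]\<^bsup>2\<^esup>" by (rule edges_A)
    show "verts (A a) \<subseteq> ?V" by (rule verts_A[OF that])
    show "edges (A a) \<subseteq> [?V]\<^bsup>2\<^esup>" using edges_A nsets_mono[OF verts_A[OF that]] by (rule order_trans)
  qed
  have iso: "isomorphic (A a) H" if a: "a < m" for a
    unfolding isomorphic_def
  proof (intro exI conjI ballI)
    have "bij_betw (inv \<sigma>) (\<sigma> ` ?B a) (?B a)"
      by (rule bij_betw_inv_into_subset[OF permutes_bij[OF \<sigma>(1)]]) auto
    moreover have "bij_betw (\<lambda>p. p mod r) (?B a) {0..<r}"
    proof (rule bij_betwI[where g = "\<lambda>x. a * r + x"])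
      fix p assume "p \<in> ?B a"
      then have "p div r = a" using blk by blast
      then show "a * r + p mod r = p" using div_mult_mod_eq[of p r] by simp
    qed (use r0 in auto)
    ultimately have "bij_betw (h \<circ> (\<lambda>p. p mod r) \<circ> inv \<sigma>) (\<sigma> ` ?B a) (verts H)"
      using h by (metis bij_betw_trans comp_assoc)
    then show "bij_betw (h \<circ> (\<lambda>p. p mod r) \<circ> inv \<sigma>) (verts (A a)) (verts H)" by (simp add: A_def)
    fix u v assume "u \<in> verts (A a)" "v \<in> verts (A a)"
    then obtain p q where pq: "p \<in> ?B a" "q \<in> ?B a" "u = \<sigma> p" "v = \<sigma> q" unfolding A_def by auto
    have "{u, v} \<in> edges (A a) \<longleftrightarrow> (p, q) \<in> G"
    proof
      assume "{u, v} \<in> edges (A a)"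
      then obtain p' q' where "(p', q') \<in> G" "{u, v} = {\<sigma> p', \<sigma> q'}" by (auto simp: A_def \<phi>_def)
      then show "(p, q) \<in> G"
        using G_sym unfolding pq(3,4) doubleton_eq_iff inj_eq[OF inj] by auto
    next
      assume "(p, q) \<in> G"
      moreover have "p div r = a" using pq(1) blk by blast
      ultimately show "{u, v} \<in> edges (A a)"
        unfolding A_def snd_conv \<phi>_def pq(3,4) by (intro image_eqI[of _ _ "(p, q)"]) auto
    qed
    also have "\<dots> \<longleftrightarrow> {h (p mod r), h (q mod r)} \<in> edges H"
    proof -
      \<comment> \<open>Edges of \<open>H\<close> have two elements, so the edge on the right
        already forces \<open>p\<close> and \<open>q\<close> to differ, as membership in
        \<open>G\<close> requires; this covers the case \<open>u = v\<close>.\<close>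
      have "h x \<noteq> h y" if "{h x, h y} \<in> edges H" for x y
        using that H(1) by (auto simp: simple_graph_def nsets_def)
      moreover have "p \<in> ?V" "q \<in> ?V" using pq(1,2) B_sub[OF a] by blast+
      moreover have "p div r = a" "q div r = a" using pq(1,2) blk by blast+
      ultimately show ?thesis by (auto simp: G_def block_graph_def)
    qed
    finally have "{u, v} \<in> edges (A a) \<longleftrightarrow> {h (p mod r), h (q mod r)} \<in> edges H" .
    then show "{u, v} \<in> edges (A a) \<longleftrightarrow>
        {(h \<circ> (\<lambda>p. p mod r) \<circ> inv \<sigma>) u, (h \<circ> (\<lambda>p. p mod r) \<circ> inv \<sigma>) v} \<in> edges H"
      using pq inv_f_f[OF inj] by simp
  qed
  have disjoint: "verts (A a) \<inter> verts (A b) = {}" if "A a \<noteq> A b" for a b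
  proof -
    have "a \<noteq> b" using that by auto
    then have "?B a \<inter> ?B b = {}" unfolding disjoint_iff blk[symmetric] by simp
    then show ?thesis unfolding A_def fst_conv image_Int[OF inj, symmetric] by (simp only: image_empty)
  qed
  have cover: "(\<Union>a<m. ?B a) = ?V"
  proof
    show "?V \<subseteq> (\<Union>a<m. ?B a)"
    proof
      fix p assume "p \<in> ?V"
      then have "p div r < m" using N by (auto simp: less_mult_imp_div_less)
      moreover have "p \<in> ?B (p div r)" using blk by blast
      ultimately show "p \<in> (\<Union>a<m. ?B a)" by blast
    qed
  qed (use B_sub in blast)
  have "H_factor H (complete_graph N) F"
    unfolding H_factor_def
  proof (intro exI[of _ "A ` {..<m}"] conjI ballI impI)
    show "verts F = (\<Union>X\<in>A ` {..<m}. verts X)"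
    proof -
      have "(\<Union>X\<in>A ` {..<m}. verts X) = \<sigma> ` (\<Union>a<m. ?B a)" by (auto simp: A_def)
      then show ?thesis unfolding cover permutes_image[OF \<sigma>(1)] by (simp add: F_def)
    qed
    show "edges F = (\<Union>X\<in>A ` {..<m}. edges X)"
      using GK N by (fastforce simp: F_def A_def block_graph_def less_mult_imp_div_less)
    show "verts F = verts (complete_graph N)" by (simp add: F_def KN)
    fix X Y assume "X \<in> A ` {..<m}" "Y \<in> A ` {..<m}" "X \<noteq> Y"
    then show "verts X \<inter> verts Y = {}" using disjoint by (elim imageE) simp
  next
    fix X assume "X \<in> A ` {..<m}"
    then obtain a where "a < m" "X = A a" by auto
    then show "subgraph X (complete_graph N)" "isomorphic X H" using sub iso by simp_all
  qed
  moreover have "discrepancy (complete_graph N) k c F \<le> real (discr_bound k r)"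
  proof -
    define \<rho> where "\<rho> = real e / real (r * (r - 1))"
    have rr: "real (r * (r - 1)) > 0" using assms(4) by simp
    have \<rho>: "0 \<le> \<rho>" "\<rho> \<le> 1" using e_le rr unfolding \<rho>_def by (simp_all only: divide_le_eq_1_pos of_nat_le_iff) simp
    have mean: "real (card G) / real k = \<rho> * (real (r - 1) * real N / real k)"
      using rr assms(3,4) unfolding card_G \<rho>_def N by (simp add: field_simps)
    have edges_F: "edges F \<subseteq> edges (complete_graph N)"
    proof
      fix x assume "x \<in> edges F"
      then obtain p q where pq: "(p, q) \<in> G" "x = {\<sigma> p, \<sigma> q}" by (auto simp: F_def \<phi>_def)
      then have "p \<in> ?V" "q \<in> ?V" using GK by (auto simp: block_graph_def)
      then show "x \<in> edges (complete_graph N)"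
        using pq G_irrefl inj permutes_in_image[OF \<sigma>(1)] by (auto simp: KN nsets_def inj_eq)
    qed
    have "\<bar>real (card (edges F \<inter> colour_class (complete_graph N) c i)) - real (card (edges F)) / real k\<bar>
        \<le> (\<bar>real_of_int (pair_count c G \<sigma> i) - \<rho> * real_of_int (pair_count c ?K \<sigma>0 i)\<bar>
          + \<bar>real_of_int (pair_count c ?K \<sigma>0 i) - real (r - 1) * real N / real k\<bar>) / 2" for i
    proof -
      have "edges F \<inter> colour_class (complete_graph N) c i = {e \<in> \<phi> ` G. c e = i}"
        using edges_F by (auto simp: colour_class_def F_def)
      then have "2 * real (card (edges F \<inter> colour_class (complete_graph N) c i)) = real_of_int (pair_count c G \<sigma> i)"
        using pair_count_eq_card[OF finG inj G_sym G_irrefl, of c i] by (simp add: \<phi>_def)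
      moreover have "2 * (real (card (edges F)) / real k) = real (card G) / real k"
        using card_ordered_pairs[OF finG inj G_sym G_irrefl] by (simp add: \<phi>_def F_def)
      moreover have "\<bar>\<rho> * real_of_int (pair_count c ?K \<sigma>0 i) - \<rho> * (real (r - 1) * real N / real k)\<bar>
          \<le> \<bar>real_of_int (pair_count c ?K \<sigma>0 i) - real (r - 1) * real N / real k\<bar>"
        unfolding right_diff_distrib[symmetric] abs_mult using \<rho> by (simp add: mult_left_le_one_le)
      moreover have "\<bar>x - y\<bar> \<le> (\<bar>p - q\<bar> + z) / 2" if "2 * x = p" "2 * y = t" "\<bar>q - t\<bar> \<le> z"
        for x y p q t z :: real
      proof -
        have "2 * \<bar>x - y\<bar> = \<bar>(p - q) + (q - t)\<bar>" 
          using that(1,2) abs_mult[of 2 "x - y"] by (auto simp: right_diff_distrib)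
        then show ?thesis using abs_triangle_ineq[of "p - q" "q - t"] that(3) by simp
      qed
      ultimately show ?thesis unfolding mean by blast
    qed
    then have "discrepancy (complete_graph N) k c F \<le>
        (\<Sum>i=1..k. (\<bar>real_of_int (pair_count c G \<sigma> i) - \<rho> * real_of_int (pair_count c ?K \<sigma>0 i)\<bar>
          + \<bar>real_of_int (pair_count c ?K \<sigma>0 i) - real (r - 1) * real N / real k\<bar>) / 2)"
      unfolding discrepancy_def by (intro sum_mono)
    also have "\<dots> \<le> real (discr_bound k r)"
      using \<sigma>(2) \<sigma>0(2) unfolding \<rho>_def[symmetric] by (simp add: sum.distrib flip: sum_divide_distrib)
    finally show ?thesis .
  qed
  ultimately show ?thesis unfolding N_def by blast
qed

theorem theorem1p1:
  fixes k r :: nat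
  assumes "k \<ge> 2" and "r \<ge> 2"
  shows "(\<exists>C :: real.
          \<forall>(H :: 'b graph) (n :: nat) (c :: nat set \<Rightarrow> nat).
            simple_graph H \<longrightarrow> card (verts H) = r \<longrightarrow> n > 0 \<longrightarrow>
            balanced_colouring (complete_graph (n * r * k)) k c \<longrightarrow>
            (\<exists>F. H_factor H (complete_graph (n * r * k)) F \<and>
                 discrepancy (complete_graph (n * r * k)) k c F \<le> C)) \<and>
         (\<forall>(H :: 'b graph) (n :: nat) (c :: nat set \<Rightarrow> nat).
            simple_graph H \<longrightarrow> card (verts H) = r \<longrightarrow> n > 0 \<longrightarrow>
            balanced_colouring (complete_graph (n * r * k)) k c \<longrightarrow>
            (\<exists>F. H_factor H (complete_graph (n * r * k)) F \<and>
                 discrepancy (complete_graph (n * r * k)) k c F \<le> (8 * real k * real r) ^ ((8 * k * r) ^ k)))"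
proof -
  have "real (discr_bound k r) \<le> real ((8 * k * r) ^ ((8 * k * r) ^ k))"
    using discr_bound_le[OF assms] by (simp only: of_nat_le_iff)
  then have "real (discr_bound k r) \<le> (8 * real k * real r) ^ ((8 * k * r) ^ k)" by simp
  then have "\<exists>F. H_factor H (complete_graph (n * r * k)) F \<and>
      discrepancy (complete_graph (n * r * k)) k c F \<le> (8 * real k * real r) ^ ((8 * k * r) ^ k)"
    if "simple_graph H" "card (verts H) = r" "n > 0" "balanced_colouring (complete_graph (n * r * k)) k c"
    for H :: "'b graph" and n c
    using factor_with_small_discrepancy[OF that(1,2) assms that(3,4)] order_trans by blast
  \<comment> \<open>The explicit bound depends on \<open>k\<close> and \<open>r\<close> only, so it
    also serves as the witness for \<open>C\<close>.\<close>
  then show ?thesis by blast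
qed

end
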